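(* Let $p \ge 2$ and $C>0$. Any feasible solution of the linear program $[\mathrm{LP}^{(p)}(C)]$ can be rounded in polynomial time into a feasible schedule of makespan at most $$\left(\frac{p}{p-\ln(p)} + \sqrt[p]{\frac{p}{\ln(p)}}\right) C,$$ where the processing time of a job $j$ on a set $S$ of machines is determined by the effective speed $\sigma^{(p)}_j(S) = \left(\sum_{i\in S} s_{i,j}^p\right)^{1/p}$. That is, there is a polynomial-time algorithm that, given an instance and a feasible solution of $[\mathrm{LP}^{(p)}(C)]$, outputs such a schedule.
   Context: An instance consists of a finite set $\mathcal{J}$ of jobs, a finite set $\mathcal{M}$ of machines, a speed $s_{i,j} \in \mathbb{Z}_+$ (non-negative integers) for each $i \in \mathcal{M}$, $j \in \mathcal{J}$, a regularizer $p\ge 1$ common to all jobs, and for each job $j$ a processing time function $f_j$ defined on $\mathbb{R}_+$ (non-negative reals), accessed by a value oracle, such that $f_j(0)=+\infty$, $f_j(s)\in\mathbb{R}_+$ for $s>0$, $f_j(s)$ is non-increasing in $s$, and $s\cdot f_j(s)$ is non-decreasing in $s>0$. For $S \subseteq \mathcal{M}$ let $\sigma^{(p)}_j(S) = \left(\sum_{i \in S} s_{i,j}^p\right)^{1/p}$ and $f_j(S) := f_j(\sigma^{(p)}_j(S))$. A feasible schedule chooses for each job $j$ a set $S_j \subseteq \mathcal{M}$ and a start time $\tau_j \ge 0$; job $j$ occupies all machines of $S_j$ (non-preemptively and in unison) during $[\tau_j, \tau_j + f_j(S_j)]$, and each machine processes at most one job at a time. The makespan is $\max_{j} (\tau_j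 + f_j(S_j))$. For a target makespan $C > 0$ let $\gamma_j = \gamma_j(C) := \min\{q \in \mathbb{Z}_+ : f_j(q) \le C\}$ (assumed to exist for every $j$) and $r_{i,j} := \max\{s_{i,j}, \gamma_j(C)\}$. The feasibility program $[\mathrm{LP}^{(p)}(C)]$ in variables $x_{i,j}$ ($i\in\mathcal{M}$, $j \in \mathcal{J}$) is: $\sum_{i \in \mathcal{M}} x_{i,j} = 1$ for all $j \in \mathcal{J}$; $\sum_{j \in \mathcal{J}} f_j(r_{i,j}) \left(\frac{r_{i,j}}{s_{i,j}}\right)^p x_{i,j} \le C$ for all $i \in \mathcal{M}$; $x_{i,j} \ge 0$ for all $i,j$. Convention: $x_{i,j} = 0$ is required whenever $s_{i,j} = 0$ (and that term is dropped from the sum). *)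

theory Defs
  imports
    Complex_Main
    "HOL-Library.Extended_Real"
    "HOL-Library.Log_Nat"
    "HOL-Computational_Algebra.Polynomial"
begin

section \<open>Instances, schedules and the linear program\<close>

text \<open>Jobs are numbered \<open>0, \<dots>, n_jobs I - 1\<close> and machines \<open>0, \<dots>, n_machines I - 1\<close>.
  Machine indices come first, as in \<open>s_{i,j}\<close>.  Values of \<open>ptime\<close> at negative speeds and all
  values at out-of-range indices are unconstrained and irrelevant.\<close>

record malleable_instance =
  n_jobs :: nat
  n_machines :: nat
  speed :: "nat \<Rightarrow> nat \<Rightarrow> nat"
  regularizer :: real
  ptime :: "nat \<Rightarrow> real \<Rightarrow> ereal"

definition jobs :: "malleable_instance \<Rightarrow> nat set" where
  "jobs I = {..<n_jobs I}"

definition machines :: "malleable_instance \<Rightarrow> nat set" where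
  "machines I = {..<n_machines I}"

definition valid_instance :: "malleable_instance \<Rightarrow> bool" where
  "valid_instance I \<longleftrightarrow>
     regularizer I \<ge> 1 \<and>
     (\<forall>j\<in>jobs I.
        ptime I j 0 = \<infinity> \<and>
        (\<forall>s>0. 0 \<le> ptime I j s \<and> ptime I j s < \<infinity>) \<and>
        (\<forall>s t. 0 \<le> s \<and> s \<le> t \<longrightarrow> ptime I j t \<le> ptime I j s) \<and>
        (\<forall>s t. 0 < s \<and> s \<le> t \<longrightarrow> ereal s * ptime I j s \<le> ereal t * ptime I j t))"

definition eff_speed :: "malleable_instance \<Rightarrow> nat \<Rightarrow> nat set \<Rightarrow> real" where
  "eff_speed I j S = (\<Sum>i\<in>S. real (speed I i j) powr regularizer I) powr (1 / regularizer I)"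

definition set_ptime :: "malleable_instance \<Rightarrow> nat \<Rightarrow> nat set \<Rightarrow> ereal" where
  "set_ptime I j S = ptime I j (eff_speed I j S)"

text \<open>A schedule gives the set \<open>S j\<close> and the start time \<open>\<tau> j\<close> of each job.  Of two jobs sharing a
  machine, one has to be completed before the other starts; starting exactly at the completion
  time of the other job is allowed.\<close>

definition feasible_schedule ::
    "malleable_instance \<Rightarrow> (nat \<Rightarrow> nat set) \<Rightarrow> (nat \<Rightarrow> real) \<Rightarrow> bool" where
  "feasible_schedule I S \<tau> \<longleftrightarrow>
     (\<forall>j\<in>jobs I. S j \<subseteq> machines I \<and> \<tau> j \<ge> 0) \<and>
     (\<forall>j\<in>jobs I. \<forall>k\<in>jobs I. j \<noteq> k \<and> S j \<inter> S k \<noteq> {} \<longrightarrow>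
        ereal (\<tau> j) + set_ptime I j (S j) \<le> ereal (\<tau> k) \<or>
        ereal (\<tau> k) + set_ptime I k (S k) \<le> ereal (\<tau> j))"

text \<open>Inserting 0 only matters when there are no jobs, as completion times are nonnegative.\<close>

definition makespan :: "malleable_instance \<Rightarrow> (nat \<Rightarrow> nat set) \<Rightarrow> (nat \<Rightarrow> real) \<Rightarrow> ereal" where
  "makespan I S \<tau> = Max (insert 0 ((\<lambda>j. ereal (\<tau> j) + set_ptime I j (S j)) ` jobs I))"

definition gamma_exists :: "malleable_instance \<Rightarrow> real \<Rightarrow> bool" where
  "gamma_exists I C \<longleftrightarrow> (\<forall>j\<in>jobs I. \<exists>q::nat. ptime I j (real q) \<le> ereal C)"

definition gamma :: "malleable_instance \<Rightarrow> real \<Rightarrow> nat \<Rightarrow> nat" where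
  "gamma I C j = (LEAST q. ptime I j (real q) \<le> ereal C)"

definition rspeed :: "malleable_instance \<Rightarrow> real \<Rightarrow> nat \<Rightarrow> nat \<Rightarrow> nat" where
  "rspeed I C i j = max (speed I i j) (gamma I C j)"

definition lp_feasible :: "malleable_instance \<Rightarrow> real \<Rightarrow> (nat \<Rightarrow> nat \<Rightarrow> real) \<Rightarrow> bool" where
  "lp_feasible I C x \<longleftrightarrow>
     (\<forall>j\<in>jobs I. (\<Sum>i\<in>machines I. x i j) = 1) \<and>
     (\<forall>i\<in>machines I.
        (\<Sum>j\<in>{j\<in>jobs I. speed I i j \<noteq> 0}.
           ptime I j (real (rspeed I C i j)) *
           ereal ((real (rspeed I C i j) / real (speed I i j)) powr regularizer I) *
           ereal (x i j)) \<le> ereal C) \<and>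
     (\<forall>i\<in>machines I. \<forall>j\<in>jobs I. x i j \<ge> 0) \<and>
     (\<forall>i\<in>machines I. \<forall>j\<in>jobs I. speed I i j = 0 \<longrightarrow> x i j = 0)"


section \<open>The model of computation\<close>

text \<open>Algorithms are programs for a real RAM with a value oracle.  There is one memory of natural
  numbers (integer inputs, counters, indices) and one of reals; both consist of named
  two-dimensional arrays.  Natural numbers support only addition and truncated subtraction, so that
  the bit length of the largest one grows by at most a constant per step.  Reals support the field
  operations, comparisons, \<open>exp\<close> and \<open>ln\<close> (which yield the powers with exponent \<open>p\<close> and
  \<open>1/p\<close>), and oracle calls.  Naturals can be converted to reals, but there is no rounding or other
  conversion back, and there are no real constants other than those obtained from naturals.\<close>

datatype nexp =
    NConst nat
  | NCell string nexp nexp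
  | NAdd nexp nexp
  | NSub nexp nexp

datatype rexp =
    RCell string nexp nexp
  | ROf nexp
  | RAdd rexp rexp
  | RSub rexp rexp
  | RMul rexp rexp
  | RDiv rexp rexp
  | RExp rexp
  | RLn rexp
  | ROracle nexp rexp

datatype bexp =
    NLess nexp nexp
  | RLess rexp rexp
  | BNot bexp
  | BAnd bexp bexp

datatype com =
    Skip
  | NAssign string nexp nexp nexp
  | RAssign string nexp nexp rexp
  | Seq com com
  | Cond bexp com com
  | While bexp com

record state =
  nmem :: "string \<Rightarrow> nat \<Rightarrow> nat \<Rightarrow> nat"
  rmem :: "string \<Rightarrow> nat \<Rightarrow> nat \<Rightarrow> real"

type_synonym oracle_fun = "nat \<Rightarrow> real \<Rightarrow> real"

primrec nval :: "state \<Rightarrow> nexp \<Rightarrow> nat" where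
  "nval \<sigma> (NConst c) = c"
| "nval \<sigma> (NCell a e1 e2) = nmem \<sigma> a (nval \<sigma> e1) (nval \<sigma> e2)"
| "nval \<sigma> (NAdd e1 e2) = nval \<sigma> e1 + nval \<sigma> e2"
| "nval \<sigma> (NSub e1 e2) = nval \<sigma> e1 - nval \<sigma> e2"

primrec rval :: "oracle_fun \<Rightarrow> state \<Rightarrow> rexp \<Rightarrow> real" where
  "rval orc \<sigma> (RCell a e1 e2) = rmem \<sigma> a (nval \<sigma> e1) (nval \<sigma> e2)"
| "rval orc \<sigma> (ROf e) = real (nval \<sigma> e)"
| "rval orc \<sigma> (RAdd e1 e2) = rval orc \<sigma> e1 + rval orc \<sigma> e2"
| "rval orc \<sigma> (RSub e1 e2) = rval orc \<sigma> e1 - rval orc \<sigma> e2"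
| "rval orc \<sigma> (RMul e1 e2) = rval orc \<sigma> e1 * rval orc \<sigma> e2"
| "rval orc \<sigma> (RDiv e1 e2) = rval orc \<sigma> e1 / rval orc \<sigma> e2"
| "rval orc \<sigma> (RExp e) = exp (rval orc \<sigma> e)"
| "rval orc \<sigma> (RLn e) = ln (rval orc \<sigma> e)"
| "rval orc \<sigma> (ROracle e1 e2) = orc (nval \<sigma> e1) (rval orc \<sigma> e2)"

primrec bval :: "oracle_fun \<Rightarrow> state \<Rightarrow> bexp \<Rightarrow> bool" where
  "bval orc \<sigma> (NLess e1 e2) = (nval \<sigma> e1 < nval \<sigma> e2)"
| "bval orc \<sigma> (RLess e1 e2) = (rval orc \<sigma> e1 < rval orc \<sigma> e2)"
| "bval orc \<sigma> (BNot b) = (\<not> bval orc \<sigma> b)"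
| "bval orc \<sigma> (BAnd b1 b2) = (bval orc \<sigma> b1 \<and> bval orc \<sigma> b2)"

definition upd2 :: "(string \<Rightarrow> nat \<Rightarrow> nat \<Rightarrow> 'a) \<Rightarrow> string \<Rightarrow> nat \<Rightarrow> nat \<Rightarrow> 'a
    \<Rightarrow> (string \<Rightarrow> nat \<Rightarrow> nat \<Rightarrow> 'a)" where
  "upd2 h a k l v = h(a := (h a)(k := (h a k)(l := v)))"

text \<open>\<open>exec orc c \<sigma> t \<sigma>'\<close>: started in \<open>\<sigma>\<close>, the program \<open>c\<close> halts in \<open>\<sigma>'\<close> after \<open>t\<close> steps.
  Each assignment and each test is one step: the number of operations and oracle calls in an
  expression is bounded by a constant that depends only on the program.\<close>

inductive exec :: "oracle_fun \<Rightarrow> com \<Rightarrow> state \<Rightarrow> nat \<Rightarrow> state \<Rightarrow> bool"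
  for orc :: oracle_fun where
  Skip: "exec orc Skip \<sigma> 1 \<sigma>"
| NAssign: "exec orc (NAssign a e1 e2 e) \<sigma> 1
    (\<sigma>\<lparr>nmem := upd2 (nmem \<sigma>) a (nval \<sigma> e1) (nval \<sigma> e2) (nval \<sigma> e)\<rparr>)"
| RAssign: "exec orc (RAssign a e1 e2 e) \<sigma> 1
    (\<sigma>\<lparr>rmem := upd2 (rmem \<sigma>) a (nval \<sigma> e1) (nval \<sigma> e2) (rval orc \<sigma> e)\<rparr>)"
| Seq: "exec orc c1 \<sigma> t1 \<sigma>' \<Longrightarrow> exec orc c2 \<sigma>' t2 \<sigma>'' \<Longrightarrow> exec orc (Seq c1 c2) \<sigma> (t1 + t2) \<sigma>''"
| CondTrue: "bval orc \<sigma> b \<Longrightarrow> exec orc c1 \<sigma> t \<sigma>' \<Longrightarrow> exec orc (Cond b c1 c2) \<sigma> (1 + t) \<sigma>'"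
| CondFalse: "\<not> bval orc \<sigma> b \<Longrightarrow> exec orc c2 \<sigma> t \<sigma>' \<Longrightarrow> exec orc (Cond b c1 c2) \<sigma> (1 + t) \<sigma>'"
| WhileFalse: "\<not> bval orc \<sigma> b \<Longrightarrow> exec orc (While b c) \<sigma> 1 \<sigma>"
| WhileTrue: "bval orc \<sigma> b \<Longrightarrow> exec orc c \<sigma> t1 \<sigma>' \<Longrightarrow> exec orc (While b c) \<sigma>' t2 \<sigma>''
    \<Longrightarrow> exec orc (While b c) \<sigma> (1 + t1 + t2) \<sigma>''"

inductive_cases exec_elims:
  "exec orc Skip \<sigma> t \<sigma>'"
  "exec orc (NAssign a e1 e2 e) \<sigma> t \<sigma>'"
  "exec orc (RAssign a e1 e2 e) \<sigma> t \<sigma>'"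
  "exec orc (Seq c1 c2) \<sigma> t \<sigma>'"
  "exec orc (Cond b c1 c2) \<sigma> t \<sigma>'"
  "exec orc (While b c) \<sigma> t \<sigma>'"

lemma exec_deterministic:
  "exec orc c \<sigma> t \<sigma>' \<Longrightarrow> exec orc c \<sigma> u \<rho> \<Longrightarrow> u = t \<and> \<rho> = \<sigma>'"
proof (induction arbitrary: u \<rho> rule: exec.induct)
  case (Skip \<sigma>)
  then show ?case by (auto elim: exec_elims(1))
next
  case (NAssign \<sigma> a e1 e2 e)
  then show ?case by (auto elim: exec_elims(2))
next
  case (RAssign \<sigma> a e1 e2 e)
  then show ?case by (auto elim: exec_elims(3))
next
  case (Seq c1 \<sigma> t1 \<sigma>' c2 t2 \<sigma>'')
  from Seq.prems obtain u1 \<rho>1 u2 where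
    "u = u1 + u2" "exec orc c1 \<sigma> u1 \<rho>1" "exec orc c2 \<rho>1 u2 \<rho>"
    by (rule exec_elims(4))
  with Seq.IH show ?case by metis
next
  case (CondTrue \<sigma> b c1 t \<sigma>' c2)
  from CondTrue.prems obtain v where "u = 1 + v" "exec orc c1 \<sigma> v \<rho>"
    by (rule exec_elims(5)) (use CondTrue.hyps in auto)
  with CondTrue.IH show ?case by metis
next
  case (CondFalse \<sigma> b c2 t \<sigma>' c1)
  from CondFalse.prems obtain v where "u = 1 + v" "exec orc c2 \<sigma> v \<rho>"
    by (rule exec_elims(5)) (use CondFalse.hyps in auto)
  with CondFalse.IH show ?case by metis
next
  case (WhileFalse \<sigma> b c)
  from WhileFalse.prems show ?case
    by (rule exec_elims(6)) (use WhileFalse.hyps in auto)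
next
  case (WhileTrue \<sigma> b c t1 \<sigma>' t2 \<sigma>'')
  from WhileTrue.prems obtain u1 \<rho>1 u2 where
    "u = 1 + u1 + u2" "exec orc c \<sigma> u1 \<rho>1" "exec orc (While b c) \<rho>1 u2 \<rho>"
    by (rule exec_elims(6)) (use WhileTrue.hyps in auto)
  with WhileTrue.IH show ?case by metis
qed


section \<open>Input, output and input size\<close>

text \<open>The value \<open>+\<infinity>\<close> that processing times take at speed 0 is answered by 0.\<close>

definition ptime_oracle :: "malleable_instance \<Rightarrow> oracle_fun" where
  "ptime_oracle I j s = real_of_ereal (ptime I j s)"

text \<open>Unused cells are initially 0.\<close>

definition input_state :: "malleable_instance \<Rightarrow> real \<Rightarrow> (nat \<Rightarrow> nat \<Rightarrow> real) \<Rightarrow> state" where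
  "input_state I C x = \<lparr>
     nmem = (\<lambda>a k l.
       if a = ''n'' \<and> k = 0 \<and> l = 0 then n_jobs I
       else if a = ''m'' \<and> k = 0 \<and> l = 0 then n_machines I
       else if a = ''s'' \<and> k \<in> machines I \<and> l \<in> jobs I then speed I k l
       else 0),
     rmem = (\<lambda>a k l.
       if a = ''p'' \<and> k = 0 \<and> l = 0 then regularizer I
       else if a = ''C'' \<and> k = 0 \<and> l = 0 then C
       else if a = ''x'' \<and> k \<in> machines I \<and> l \<in> jobs I then x k l
       else 0) \<rparr>"

definition output_set :: "malleable_instance \<Rightarrow> state \<Rightarrow> nat \<Rightarrow> nat set" where
  "output_set I \<sigma> j = {i \<in> machines I. nmem \<sigma> ''S'' i j \<noteq> 0}"

definition output_start :: "state \<Rightarrow> nat \<Rightarrow> real" where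
  "output_start \<sigma> j = rmem \<sigma> ''tau'' j 0"

text \<open>Each real input counts as one unit, each speed with its bit length (\<open>floorlog 2\<close>).\<close>

definition input_size :: "malleable_instance \<Rightarrow> nat" where
  "input_size I = n_jobs I + n_machines I +
     (\<Sum>i\<in>machines I. \<Sum>j\<in>jobs I. 1 + floorlog 2 (speed I i j))"

end

theory Submission
  imports Defs
begin

text \<open>Consider the bipartite graph of jobs and machines.  On a cycle of the support, shift weight
  so that all constraints keep their value except the load of one machine, which does not grow;
  the shift stops when an edge becomes empty.  Hence the support can be assumed to be a forest,
  which is kept as a rooted forest while the edges are inserted one by one.  Put
  \<open>\<theta> = 1 - ln p / p\<close>.  A job with a share of at least \<open>\<theta>\<close> on some machine runs there alone; these
  jobs need at most \<open>C / \<theta>\<close> time on every machine.  Every other job runs on all its children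
  simultaneously.  It loses only the edge to its parent, so it keeps a share of at least \<open>ln p / p\<close>
  and needs at most \<open>(p / ln p) powr (1 / p) * C\<close> time.  Each machine is a child of at most one job,
  so all these jobs start at time 0, and the single-machine jobs follow.\<close>


section \<open>Forests given by parent pointers\<close>

text \<open>A cycle has as many edge variables as vertex constraints, so keeping every constraint
  would in general force the zero shift. Solving the balances one vertex after the other leaves only
  the start vertex unbalanced; it is chosen to be a machine, because a load is an inequality, and
  the sign of the shift makes that load move downwards. The solution divides by coefficients, so
  edges with \<open>a i j = 0\<close> stay outside the forest and keep their weight; any positive
  share on such an edge already lets the job run on that machine alone, in time 0. One insertion
  creates at most one cycle, hence one cancellation per edge and no potential argument for the
  running time. The two summands of the bound are the two sides of the threshold: a share of at
  least \<open>theta\<close> costs the factor 1 / \<open>theta\<close> = p / (p - ln p), whereas a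
  share of at least 1 - \<open>theta\<close> = ln p / p costs only the p-th root of its inverse,
  since p-th powers of speeds add up. They are added because the single-machine jobs wait for a
  common time by which all split jobs are done.\<close>

text \<open>\<open>par v = Suc u\<close> means that \<open>u\<close> is the parent of \<open>v\<close>; roots have \<open>par v = 0\<close>.\<close>

definition acyclic_ptr :: "(nat \<Rightarrow> nat) \<Rightarrow> bool" where
  "acyclic_ptr par \<longleftrightarrow> (\<exists>rk :: nat \<Rightarrow> nat. \<forall>v u. par v = Suc u \<longrightarrow> rk u < rk v)"

definition adj :: "(nat \<Rightarrow> nat) \<Rightarrow> nat \<Rightarrow> nat \<Rightarrow> bool" where
  "adj par u v \<longleftrightarrow> par u = Suc v \<or> par v = Suc u"

definition chain :: "(nat \<Rightarrow> nat) \<Rightarrow> (nat \<Rightarrow> nat) \<Rightarrow> nat \<Rightarrow> bool" where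
  "chain par p L \<longleftrightarrow> (\<forall>t<L. par (p t) = Suc (p (Suc t)))"

text \<open>The rank strictly decreases along pointers, so a pointer path never revisits a vertex.
  This bounds the length of every walk by the number of vertices.\<close>

lemma chain_inj_on:
  assumes "acyclic_ptr par" "chain par p L"
  shows "inj_on p {..L}"
proof -
  obtain rk :: "nat \<Rightarrow> nat" where rk: "\<And>v u. par v = Suc u \<Longrightarrow> rk u < rk v"
    using assms(1) unfolding acyclic_ptr_def by blast
  have "rk (p t) < rk (p s)" if "s < t" "t \<le> L" for s t
    using that
  proof (induction t)
    case (Suc t)
    have step: "rk (p (Suc t)) < rk (p t)"
      using assms(2) Suc.prems rk unfolding chain_def by auto
    show ?case
    proof (cases "s = t")
      case False
      then show ?thesis using Suc step by fastforce
    qed (use step in auto)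
  qed auto
  then show ?thesis
    by (intro linorder_inj_onI) (auto, metis less_irrefl)
qed

lemma chain_length_less:
  assumes "acyclic_ptr par" "chain par p L" "\<forall>t\<le>L. p t < N"
  shows "L < N"
proof -
  have "card {..L} \<le> card {..<N}"
    by (rule card_inj_on_le[OF chain_inj_on[OF assms(1,2)]]) (use assms(3) in auto)
  then show ?thesis by simp
qed

locale rerooting =
  fixes par par' p :: "nat \<Rightarrow> nat" and L :: nat
  assumes acyclic: "acyclic_ptr par" and chain: "chain par p L" and root: "par (p L) = 0"
    and new_root: "par' (p 0) = 0" and reversed: "\<And>t. t < L \<Longrightarrow> par' (p (Suc t)) = Suc (p t)"
    and unchanged: "\<And>v. v \<notin> p ` {..L} \<Longrightarrow> par' v = par v"
begin

text \<open>The support condition is phrased with the undirected \<open>adj\<close> so that it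
  survives the reversal of a path.\<close>

lemma adj_iff: "adj par' u v \<longleftrightarrow> adj par u v"
proof -
  have 1: "adj par u v" if "par' u = Suc v" for u v
  proof (cases "u \<in> p ` {..L}")
    case True
    then obtain t where t: "t \<le> L" "u = p t" by auto
    then show ?thesis
      using that new_root reversed chain unfolding chain_def adj_def by (cases t) auto
  qed (use that unchanged adj_def in auto)
  have 2: "adj par' u v" if "par u = Suc v" for u v
  proof (cases "u \<in> p ` {..L}")
    case True
    then obtain t where t: "t \<le> L" "u = p t" by auto
    then show ?thesis
      using that root reversed chain unfolding chain_def adj_def by (cases "t = L") auto
  qed (use that unchanged adj_def in auto)
  show ?thesis using 1 2 unfolding adj_def by metis
qed

text \<open>New ranks: a path vertex gets its position, since reversed pointers run towards
  \<open>p 0\<close>; all other vertices are lifted above \<open>L\<close>, so their pointers into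
  the path still descend.\<close>

lemma acyclic': "acyclic_ptr par'"
proof -
  obtain rk :: "nat \<Rightarrow> nat" where rk: "\<And>v u. par v = Suc u \<Longrightarrow> rk u < rk v"
    using acyclic unfolding acyclic_ptr_def by blast
  have inj: "inj_on p {..L}" using acyclic chain by (rule chain_inj_on)
  define ix where "ix = the_inv_into {..L} p"
  have ix: "ix (p t) = t" if "t \<le> L" for t
    unfolding ix_def using inj that by (simp add: the_inv_into_f_f)
  define rk' where "rk' v = (if v \<in> p ` {..L} then ix v else Suc L + rk v)" for v
  have le: "rk' v \<le> L" if "v \<in> p ` {..L}" for v using that ix unfolding rk'_def by auto
  have "rk' u < rk' v" if "par' v = Suc u" for v u
  proof (cases "v \<in> p ` {..L}")
    case True
    then obtain t where t: "t \<le> L" "v = p t" by auto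
    show ?thesis
    proof (cases t)
      case 0 then show ?thesis using t that new_root by simp
    next
      case (Suc k)
      then have "u = p k" using t that reversed by simp
      then show ?thesis using t Suc ix[of k] ix[of "Suc k"] by (simp add: rk'_def)
    qed
  next
    case False
    then have "par v = Suc u" using that unchanged by simp
    then have "rk u < rk v" by (rule rk)
    moreover have "rk' v = Suc L + rk v" using False by (simp add: rk'_def)
    ultimately show ?thesis using le[of u] by (cases "u \<in> p ` {..L}") (auto simp: rk'_def)
  qed
  then show ?thesis unfolding acyclic_ptr_def by blast
qed

end

text \<open>Pointers from \<open>p 0\<close> lead to the root \<open>p L\<close>, so the root
  \<open>j\<close> lies in another tree. Lifting the ranks of the whole tree of \<open>j\<close> by
  a constant puts \<open>j\<close> above \<open>p 0\<close>.\<close>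

lemma acyclic_ptr_link:
  assumes acyc: "acyclic_ptr par" and chain: "chain par p L" and root: "par (p L) = 0"
    and j: "par j = 0" "p L \<noteq> j"
  shows "acyclic_ptr (par(j := Suc (p 0)))"
proof -
  obtain rk :: "nat \<Rightarrow> nat" where rk: "\<And>v u. par v = Suc u \<Longrightarrow> rk u < rk v"
    using acyc unfolding acyclic_ptr_def by blast
  define E where "E = {(v, u). par v = Suc u}"
  have reach: "\<exists>t\<le>L. v = p t" if "(p 0, v) \<in> E\<^sup>*" for v
    using that
  proof (induction rule: rtrancl_induct)
    case (step v w)
    then obtain t where t: "t \<le> L" "v = p t" by blast
    have "t < L" using t step(2) root by (cases "t = L") (auto simp: E_def)
    moreover have "w = p (Suc t)" using chain t step(2) \<open>t < L\<close> by (auto simp: E_def chain_def)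
    ultimately show ?case by (intro exI[of _ "Suc t"]) auto
  qed auto
  have "(p 0, j) \<notin> E\<^sup>*"
  proof
    assume "(p 0, j) \<in> E\<^sup>*"
    from reach[OF this] obtain t where t: "t \<le> L" "j = p t" by blast
    then show False using j chain unfolding chain_def by (cases "t = L") auto
  qed
  define rk' where "rk' v = (if (v, j) \<in> E\<^sup>* then Suc (rk (p 0)) + rk v else rk v)" for v
  have "rk' u < rk' v" if "(par(j := Suc (p 0))) v = Suc u" for v u
  proof (cases "v = j")
    case True
    then show ?thesis using that \<open>(p 0, j) \<notin> E\<^sup>*\<close> by (auto simp: rk'_def)
  next
    case False
    then have *: "par v = Suc u" using that by simp
    then have "(v, u) \<in> E" by (simp add: E_def)
    then have "(u, j) \<in> E\<^sup>* \<Longrightarrow> (v, j) \<in> E\<^sup>*" by (rule converse_rtrancl_into_rtrancl)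
    then show ?thesis using rk[OF *] by (auto simp: rk'_def)
  qed
  then show ?thesis unfolding acyclic_ptr_def by blast
qed

lemma acyclic_ptr_cut: "acyclic_ptr par \<Longrightarrow> acyclic_ptr (par(v := 0))"
  unfolding acyclic_ptr_def by (metis fun_upd_other fun_upd_same nat.distinct(1))


section \<open>Shifting weight along a cycle\<close>

definition cycle_vec :: "(nat \<Rightarrow> nat) \<Rightarrow> (nat \<Rightarrow> real) \<Rightarrow> nat \<Rightarrow> nat \<Rightarrow> nat \<Rightarrow> real" where
  "cycle_vec p y K u v = (\<Sum>k<K. y k * (of_bool (u = p k \<and> v = p (Suc k)) + of_bool (v = p k \<and> u = p (Suc k))))"

lemma cycle_vec_sym: "cycle_vec p y K u v = cycle_vec p y K v u"
  unfolding cycle_vec_def by (rule sum.cong) auto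

text \<open>The length is a parameter because the vector of the first \<open>K\<close> edges
  describes the change made by \<open>K\<close> rounds of \<open>push_com\<close>, each of which
  writes both orientations of one edge.\<close>

lemma cycle_vec_Suc:
  "cycle_vec p y (Suc K) u v = cycle_vec p y K u v +
     y K * (of_bool (u = p K \<and> v = p (Suc K)) + of_bool (v = p K \<and> u = p (Suc K)))"
  unfolding cycle_vec_def by simp

text \<open>With \<open>2 \<le> L\<close> the cycle has at least three edges, so no edge is
  traversed in both directions. Position \<open>Suc L\<close> is a copy of position 0.\<close>

locale closed_walk =
  fixes p :: "nat \<Rightarrow> nat" and L N :: nat
  assumes inj: "inj_on p {..L}" and closed: "p (Suc L) = p 0" and long: "2 \<le> L"
    and bound: "\<And>t. t \<le> L \<Longrightarrow> p t < N"
begin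

lemma eq_iff: "s \<le> L \<Longrightarrow> t \<le> L \<Longrightarrow> p s = p t \<longleftrightarrow> s = t"
  using inj by (auto simp: inj_on_def)

lemma eq_Suc_iff:
  "s \<le> L \<Longrightarrow> t \<le> L \<Longrightarrow> p s = p (Suc t) \<longleftrightarrow> (if t = L then s = 0 else s = Suc t)"
  using eq_iff[of s "Suc t"] eq_iff[of s 0] closed by auto

lemma Suc_bound: "t \<le> L \<Longrightarrow> p (Suc t) < N"
  using bound[of "Suc t"] bound[of 0] closed by (cases "t = L") auto

lemma cycle_vec_edge:
  assumes "k \<le> L"
  shows "cycle_vec p y (Suc L) (p k) (p (Suc k)) = y k"
proof -
  have "cycle_vec p y (Suc L) (p k) (p (Suc k)) = (\<Sum>k'<Suc L. if k' = k then y k else 0)"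
    unfolding cycle_vec_def
  proof (rule sum.cong)
    fix k' assume "k' \<in> {..<Suc L}"
    then have k': "k' \<le> L" by simp
    have 1: "p k = p k' \<longleftrightarrow> k' = k" using eq_iff assms k' by auto
    \<comment> \<open>Otherwise edge \<open>k'\<close> would be both the successor and the
      predecessor of edge \<open>k\<close>, which happens only on cycles with at most two
      edges.\<close>
    have 2: "\<not> (p (Suc k) = p k' \<and> p k = p (Suc k'))"
    proof (rule notI, elim conjE)
      assume eqs: "p (Suc k) = p k'" "p k = p (Suc k')"
      have "k = L \<and> k' = 0 \<or> k' = Suc k"
        using iffD1[OF eq_Suc_iff[OF k' assms] eqs(1)[symmetric]] by (cases "k = L") auto
      moreover have "k' = L \<and> k = 0 \<or> k = Suc k'"
        using iffD1[OF eq_Suc_iff[OF assms k'] eqs(2)] by (cases "k' = L") auto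
      ultimately show False using long by linarith
    qed
    show "y k' * (of_bool (p k = p k' \<and> p (Suc k) = p (Suc k')) +
        of_bool (p (Suc k) = p k' \<and> p k = p (Suc k'))) = (if k' = k then y k else 0)"
      using 1 2 by auto
  qed simp
  also have "\<dots> = y k" using assms by (simp add: sum.delta)
  finally show ?thesis .
qed

lemma cycle_vec_eq_0:
  assumes "\<And>k. k \<le> L \<Longrightarrow> \<not> (u = p k \<and> v = p (Suc k)) \<and> \<not> (v = p k \<and> u = p (Suc k))"
  shows "cycle_vec p y (Suc L) u v = 0"
proof -
  have "of_bool (u = p k \<and> v = p (Suc k)) + of_bool (v = p k \<and> u = p (Suc k)) = (0::real)"
    if "k \<in> {..<Suc L}" for k
  proof -
    have "k \<le> L" using that by simp
    then have "(u = p k \<and> v = p (Suc k)) = False" "(v = p k \<and> u = p (Suc k)) = False"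
      using assms by blast+
    then show ?thesis by (simp only: of_bool_eq add_0)
  qed
  then show ?thesis unfolding cycle_vec_def by simp
qed

lemma sum_cycle_vec:
  "(\<Sum>u<N. c v u * cycle_vec p y (Suc L) v u) =
   (\<Sum>k\<le>L. of_bool (v = p k) * (c v (p (Suc k)) * y k)) +
   (\<Sum>k\<le>L. of_bool (v = p (Suc k)) * (c v (p k) * y k))"
proof -
  have "(\<Sum>u<N. c v u * cycle_vec p y (Suc L) v u) =
     (\<Sum>u<N. \<Sum>k\<le>L. c v u * (y k * (of_bool (v = p k \<and> u = p (Suc k)) + of_bool (u = p k \<and> v = p (Suc k)))))"
    unfolding cycle_vec_def sum_distrib_left lessThan_Suc_atMost ..
  also have "\<dots> = (\<Sum>k\<le>L. \<Sum>u<N. c v u * (y k * (of_bool (v = p k \<and> u = p (Suc k)) + of_bool (u = p k \<and> v = p (Suc k)))))"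
    by (rule sum.swap)
  also have "\<dots> = (\<Sum>k\<le>L. of_bool (v = p k) * (c v (p (Suc k)) * y k) + of_bool (v = p (Suc k)) * (c v (p k) * y k))"
  proof (rule sum.cong)
    fix k assume "k \<in> {..L}"
    then have k: "k \<le> L" by simp
    have "(\<Sum>u<N. c v u * (y k * (of_bool (v = p k \<and> u = p (Suc k)) + of_bool (u = p k \<and> v = p (Suc k))))) =
       (\<Sum>u<N. (if u = p (Suc k) then of_bool (v = p k) * (c v (p (Suc k)) * y k) else 0) +
              (if u = p k then of_bool (v = p (Suc k)) * (c v (p k) * y k) else 0))"
      by (rule sum.cong) (auto simp: algebra_simps)
    also have "\<dots> = of_bool (v = p k) * (c v (p (Suc k)) * y k) + of_bool (v = p (Suc k)) * (c v (p k) * y k)"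
      unfolding sum.distrib using Suc_bound[OF k] bound[OF k] by (simp add: sum.delta)
    finally show "(\<Sum>u<N. c v u * (y k * (of_bool (v = p k \<and> u = p (Suc k)) + of_bool (u = p k \<and> v = p (Suc k))))) =
       of_bool (v = p k) * (c v (p (Suc k)) * y k) + of_bool (v = p (Suc k)) * (c v (p k) * y k)" .
  qed simp
  finally show ?thesis by (simp add: sum.distrib)
qed

lemma sum_cycle_vec_off:
  assumes "v \<notin> p ` {..L}"
  shows "(\<Sum>u<N. c v u * cycle_vec p y (Suc L) v u) = 0"
proof -
  have "v \<noteq> p k \<and> v \<noteq> p (Suc k)" if "k \<le> L" for k
    using assms that closed by (cases "k = L") (auto simp: image_iff)
  then show ?thesis unfolding sum_cycle_vec by simp
qed

text \<open>A vertex of the cycle meets only its outgoing edge \<open>t\<close> and its incoming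
  edge \<open>s\<close>; the form \<open>p t = p (Suc s)\<close> covers the wrap-around
  \<open>t = 0\<close>, \<open>s = L\<close> as well.\<close>

lemma sum_cycle_vec_on:
  assumes "s \<le> L" "t \<le> L" "p t = p (Suc s)"
  shows "(\<Sum>u<N. c (p t) u * cycle_vec p y (Suc L) (p t) u) = c (p t) (p (Suc t)) * y t + c (p t) (p s) * y s"
proof -
  have "(\<Sum>k\<le>L. of_bool (p t = p k) * (c (p t) (p (Suc k)) * y k)) =
        (\<Sum>k\<le>L. if k = t then c (p t) (p (Suc t)) * y t else 0)"
    by (rule sum.cong) (use eq_iff assms in auto)
  moreover have "(\<Sum>k\<le>L. of_bool (p t = p (Suc k)) * (c (p t) (p k) * y k)) =
        (\<Sum>k\<le>L. if k = s then c (p t) (p s) * y s else 0)"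
  proof (rule sum.cong)
    fix k assume "k \<in> {..L}"
    then have "p t = p (Suc k) \<longleftrightarrow> k = s"
      using eq_Suc_iff[of t k] eq_Suc_iff[of t s] assms by (auto split: if_splits)
    then show "of_bool (p t = p (Suc k)) * (c (p t) (p k) * y k) = (if k = s then c (p t) (p s) * y s else 0)"
      by auto
  qed simp
  ultimately show ?thesis unfolding sum_cycle_vec using assms by (simp add: sum.delta)
qed

end

text \<open>\<open>c v u\<close> is the coefficient of the edge \<open>u v\<close> in the constraint
  of \<open>v\<close>, so \<open>c\<close> need not be symmetric although the weights are.
  Constraints of vertices below \<open>n\<close> are equations, the others upper bounds.
  \<open>W\<close> holds the edges inserted so far. Pointers must cover the support within
  \<open>W\<close>, but may also run along edges of weight 0. Pairs without positive coefficients in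
  both directions keep their original weight.\<close>

definition forest_inv ::
  "nat \<Rightarrow> nat \<Rightarrow> (nat \<Rightarrow> nat \<Rightarrow> real) \<Rightarrow> (nat \<Rightarrow> nat \<Rightarrow> real) \<Rightarrow> (nat \<times> nat) set \<Rightarrow> (nat \<Rightarrow> nat \<Rightarrow> real) \<Rightarrow> (nat \<Rightarrow> nat) \<Rightarrow> bool"
where
  "forest_inv N n c X0 W X par \<longleftrightarrow>
     (\<forall>v u. par v = Suc u \<longrightarrow> v < N \<and> u < N \<and> 0 < c v u \<and> 0 < c u v) \<and>
     acyclic_ptr par \<and>
     (\<forall>u v. X u v = X v u) \<and> (\<forall>u v. 0 \<le> X u v) \<and>
     (\<forall>u v. \<not> (0 < c u v \<and> 0 < c v u) \<longrightarrow> X u v = X0 u v) \<and>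
     (\<forall>v<n. (\<Sum>u<N. c v u * X v u) = (\<Sum>u<N. c v u * X0 v u)) \<and>
     (\<forall>v<N. (\<Sum>u<N. c v u * X v u) \<le> (\<Sum>u<N. c v u * X0 v u)) \<and>
     (\<forall>(u, v)\<in>W. 0 < X u v \<longrightarrow> adj par u v)"

lemma forest_inv_insert:
  "forest_inv N n c X0 W X par \<Longrightarrow> adj par u v \<Longrightarrow> forest_inv N n c X0 (insert (u, v) W) X par"
  unfolding forest_inv_def by auto

lemma forest_inv_reroot:
  assumes "forest_inv N n c X0 W X par" "rerooting par par' p L"
  shows "forest_inv N n c X0 W X par'"
proof -
  interpret rerooting par par' p L by fact
  have "v < N \<and> u < N \<and> 0 < c v u \<and> 0 < c u v" if "par' v = Suc u" for v u
  proof -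
    have "adj par v u" using that adj_iff unfolding adj_def by blast
    then show ?thesis using assms(1) unfolding adj_def forest_inv_def by auto
  qed
  then show ?thesis using assms(1) acyclic' adj_iff unfolding forest_inv_def by auto
qed

lemma forest_inv_link:
  assumes F: "forest_inv N n c X0 W X par" and chain: "chain par p L" and root: "par (p L) = 0"
    and j: "par j = 0" "p L \<noteq> j" and lt: "j < N" "p 0 < N" and c: "0 < c j (p 0)" "0 < c (p 0) j"
  shows "forest_inv N n c X0 (insert (p 0, j) W) X (par(j := Suc (p 0)))"
proof -
  have "acyclic_ptr (par(j := Suc (p 0)))"
    using F by (intro acyclic_ptr_link[OF _ chain root j]) (simp add: forest_inv_def)
  moreover have "adj (par(j := Suc (p 0))) u v" if "adj par u v" for u v
    using that j unfolding adj_def by auto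
  moreover have "adj (par(j := Suc (p 0))) (p 0) j" unfolding adj_def by simp
  ultimately show ?thesis using F lt c unfolding forest_inv_def by auto
qed

text \<open>All balances along the cycle are kept except the one at \<open>p 0\<close>, whose change has the sign
  that is assumed in \<open>descent\<close>; the step length \<open>th\<close> empties the edge \<open>b\<close>.\<close>

lemma forest_inv_cancel:
  assumes F: "forest_inv N n c X0 W X par"
    and walk: "closed_walk p L N" and n: "n \<le> p 0"
    and chain: "chain par p L" and root: "par (p L) = 0"
    and pos: "\<And>k. k \<le> L \<Longrightarrow> 0 < c (p k) (p (Suc k)) \<and> 0 < c (p (Suc k)) (p k)"
    and balance: "\<And>k. k < L \<Longrightarrow> c (p (Suc k)) (p (Suc (Suc k))) * y (Suc k) + c (p (Suc k)) (p k) * y k = 0"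
    and descent: "c (p 0) (p 1) * y 0 + c (p 0) (p L) * y L \<le> 0"
    and b: "b \<le> L" "y b < 0"
    and b_min: "\<And>k. k \<le> L \<Longrightarrow> y k < 0 \<Longrightarrow> X (p b) (p (Suc b)) / (- y b) \<le> X (p k) (p (Suc k)) / (- y k)"
    and th: "th = X (p b) (p (Suc b)) / (- y b)"
    and X': "\<And>u v. X' u v = X u v + th * cycle_vec p y (Suc L) u v"
    and par': "par' = (if b = L then par else (par(p b := 0))(p L := Suc (p 0)))"
  shows "forest_inv N n c X0 (insert (p 0, p L) W) X' par'"
proof -
  interpret closed_walk p L N by fact
  have X0: "0 \<le> X u v" "X u v = X v u" for u v using F unfolding forest_inv_def by auto
  have th0: "0 \<le> th" using X0 b unfolding th by (simp add: divide_nonneg_nonpos)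
  have edge: "X' (p k) (p (Suc k)) = X (p k) (p (Suc k)) + th * y k" if "k \<le> L" for k
    using that by (simp add: X' cycle_vec_edge)
  have b0: "X' (p b) (p (Suc b)) = 0" using edge[OF b(1)] b(2) unfolding th by (simp add: field_simps)
  have sym: "X' u v = X' v u" for u v using X0 by (simp add: X' cycle_vec_sym[of p y _ u v])
  \<comment> \<open>\<open>th\<close> is the least ratio over all decreasing edges, so none of them
    drops below 0.\<close>
  have edge_nonneg: "0 \<le> X' (p k) (p (Suc k))" if "k \<le> L" for k
  proof (cases "y k < 0")
    case True
    then have "th \<le> X (p k) (p (Suc k)) / (- y k)" using b_min that th by simp
    then have "th * (- y k) \<le> X (p k) (p (Suc k))"
      using True pos_le_divide_eq[of "- y k" th "X (p k) (p (Suc k))"] by (simp del: divide_minus_right)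
    then show ?thesis using edge[OF that] by simp
  next
    case False
    then show ?thesis using edge[OF that] X0 th0 by simp
  qed
  have off: "X' u v = X u v" if "\<And>k. k \<le> L \<Longrightarrow> \<not> (u = p k \<and> v = p (Suc k)) \<and> \<not> (v = p k \<and> u = p (Suc k))" for u v
    using cycle_vec_eq_0[OF that] X' by simp
  have nonneg: "0 \<le> X' u v" for u v
  proof (cases "\<exists>k\<le>L. (u = p k \<and> v = p (Suc k)) \<or> (v = p k \<and> u = p (Suc k))")
    case True
    then show ?thesis using edge_nonneg sym by metis
  next
    case False
    then have "X' u v = X u v" by (intro off) auto
    then show ?thesis using X0 by simp
  qed
  have fixed: "X' u v = X u v" if "\<not> (0 < c u v \<and> 0 < c v u)" for u v
    by (rule off) (use that pos in blast)
  have sum': "(\<Sum>u<N. c v u * X' v u) = (\<Sum>u<N. c v u * X v u) + th * (\<Sum>u<N. c v u * cycle_vec p y (Suc L) v u)" for v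
    unfolding X' sum_distrib_left sum.distrib[symmetric] by (rule sum.cong) (auto simp: algebra_simps)
  have bal: "(\<Sum>u<N. c v u * cycle_vec p y (Suc L) v u) = 0" if "v \<noteq> p 0" for v
  proof (cases "v \<in> p ` {..L}")
    case True
    then obtain t where t: "t \<le> L" "v = p t" by auto
    with that obtain k where k: "t = Suc k" by (cases t) auto
    show ?thesis using sum_cycle_vec_on[of k t c y] balance[of k] t k by simp
  qed (rule sum_cycle_vec_off)
  have bal0: "(\<Sum>u<N. c (p 0) u * cycle_vec p y (Suc L) (p 0) u) \<le> 0"
    using sum_cycle_vec_on[of L 0 c y] descent closed by simp
  have le: "(\<Sum>u<N. c v u * X' v u) \<le> (\<Sum>u<N. c v u * X v u)" for v
    unfolding sum' using bal[of v] bal0 th0 by (cases "v = p 0") (auto intro: mult_nonneg_nonpos)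
  have eq: "(\<Sum>u<N. c v u * X' v u) = (\<Sum>u<N. c v u * X v u)" if "v < n" for v
    unfolding sum' using bal[of v] that n by simp
  \<comment> \<open>Apart from the closing edge, weight changes only on edges that already are
    pointers.\<close>
  have supp: "adj par u v \<or> {u, v} = {p 0, p L}" if "0 < X' u v" "(u, v) \<in> W" for u v
  proof (cases "\<exists>k\<le>L. (u = p k \<and> v = p (Suc k)) \<or> (v = p k \<and> u = p (Suc k))")
    case True
    then obtain k where k: "k \<le> L" "(u = p k \<and> v = p (Suc k)) \<or> (v = p k \<and> u = p (Suc k))" by blast
    show ?thesis
    proof (cases "k = L")
      case True
      then show ?thesis using k closed by auto
    next
      case False
      then show ?thesis using k chain unfolding chain_def adj_def by auto
    qed
  next
    case False
    then have "X' u v = X u v" by (intro off) auto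
    then show ?thesis using that F unfolding forest_inv_def by auto
  qed
  have par: "v < N \<and> u < N \<and> 0 < c v u \<and> 0 < c u v" if "par v = Suc u" for u v
    using F that unfolding forest_inv_def by blast
  have acyc: "acyclic_ptr par" using F unfolding forest_inv_def by blast
  have props: "\<forall>v<n. (\<Sum>u<N. c v u * X' v u) = (\<Sum>u<N. c v u * X0 v u)"
    "\<forall>v<N. (\<Sum>u<N. c v u * X' v u) \<le> (\<Sum>u<N. c v u * X0 v u)"
    "\<forall>u v. \<not> (0 < c u v \<and> 0 < c v u) \<longrightarrow> X' u v = X0 u v"
    using F eq le fixed unfolding forest_inv_def by (simp, meson order_trans, simp)
  show ?thesis
  proof (cases "b = L")
    case True
    \<comment> \<open>The new edge itself is emptied, so the old pointers still cover the
      support.\<close>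
    have "X' (p 0) (p L) = 0" using b0 True closed sym by simp
    then have "\<forall>(u, v)\<in>insert (p 0, p L) W. 0 < X' u v \<longrightarrow> adj par u v"
      using supp sym by (force simp: doubleton_eq_iff)
    then show ?thesis using True par acyc sym nonneg props unfolding forest_inv_def par' by auto
  next
    case False
    then have "b < L" using b by simp
    \<comment> \<open>The cut makes \<open>p b\<close> the root of the part containing
      \<open>p 0\<close>, while \<open>p L\<close> is still a root. Hanging \<open>p L\<close> below
      \<open>p 0\<close> thus joins two different trees, without any further rerooting.\<close>
    let ?par = "par(p b := 0)"
    have chain': "chain ?par p b" using chain \<open>b < L\<close> eq_iff unfolding chain_def by auto
    have "p b \<noteq> p L" using \<open>b < L\<close> eq_iff by auto
    then have "acyclic_ptr (?par(p L := Suc (p 0)))"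
      using root by (intro acyclic_ptr_link[OF acyclic_ptr_cut[OF acyc] chain']) auto
    then have acyc': "acyclic_ptr par'" using False by (simp add: par')
    have valid': "v < N \<and> u < N \<and> 0 < c v u \<and> 0 < c u v" if "par' v = Suc u" for u v
    proof (cases "v = p L")
      case True
      then show ?thesis using that False pos[of L] bound[of 0] bound[of L] closed by (simp add: par')
    next
      case neq: False
      then have "par v = Suc u" using that False by (simp add: par' split: if_splits)
      then show ?thesis by (rule par)
    qed
    \<comment> \<open>Only the pointers of \<open>p b\<close> and \<open>p L\<close> change: the
      edge of the former is now empty, and the root \<open>p L\<close> had none.\<close>
    have keep: "adj par' u v" if "adj par u v" "0 < X' u v" for u v
    proof -
      have "par' u = Suc v" if "par u = Suc v" "0 < X' u v" for u v
      proof -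
        have "u \<noteq> p L" using that root by auto
        moreover have "u \<noteq> p b"
          using that chain b0 \<open>b < L\<close> unfolding chain_def by auto
        ultimately show ?thesis using that False by (simp add: par')
      qed
      then show ?thesis using that sym unfolding adj_def by metis
    qed
    have new: "adj par' (p 0) (p L)" "adj par' (p L) (p 0)" using False by (simp_all add: par' adj_def)
    have "adj par' u v" if "(u, v) \<in> insert (p 0, p L) W" "0 < X' u v" for u v
    proof (cases "adj par u v")
      case False
      then have "{u, v} = {p 0, p L}" using supp that by blast
      then show ?thesis using new by (auto simp: doubleton_eq_iff)
    qed (use keep that in blast)
    then have "\<forall>(u, v)\<in>insert (p 0, p L) W. 0 < X' u v \<longrightarrow> adj par' u v" by blast
    then show ?thesis
      unfolding forest_inv_def using acyc' valid' sym nonneg props by (intro conjI) blast+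
  qed
qed


section \<open>Consequences of the linear program\<close>

locale lp_solution =
  fixes I :: malleable_instance and C :: real and x :: "nat \<Rightarrow> nat \<Rightarrow> real"
  assumes valid: "valid_instance I" and reg: "2 \<le> regularizer I" and C_pos: "0 < C"
    and gamma_ex: "gamma_exists I C" and feasible: "lp_feasible I C x"
begin

abbreviation "n \<equiv> n_jobs I"
abbreviation "m \<equiv> n_machines I"
abbreviation "s \<equiv> speed I"
abbreviation "p \<equiv> regularizer I"
abbreviation "f \<equiv> ptime_oracle I"
abbreviation "g \<equiv> gamma I C"

text \<open>The value 0 for the terms dropped from the program turns the load constraints into sums
  over all jobs and keeps edges of speed 0 out of the forest.\<close>

definition a :: "nat \<Rightarrow> nat \<Rightarrow> real" where
  "a i j = (if s i j = 0 then 0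
     else f j (real (rspeed I C i j)) * (real (rspeed I C i j) / real (s i j)) powr p)"

lemma ptime_eq: "j < n \<Longrightarrow> 0 < t \<Longrightarrow> ptime I j t = ereal (f j t)"
  and f_nonneg: "j < n \<Longrightarrow> 0 < t \<Longrightarrow> 0 \<le> f j t"
proof -
  assume "j < n" "0 < t"
  then have "0 \<le> ptime I j t \<and> ptime I j t < \<infinity>"
    using valid unfolding valid_instance_def jobs_def by auto
  then show "ptime I j t = ereal (f j t)" "0 \<le> f j t"
    unfolding ptime_oracle_def by (cases "ptime I j t"; simp)+
qed

lemma ptime_0: "j < n \<Longrightarrow> ptime I j 0 = \<infinity>"
  using valid unfolding valid_instance_def jobs_def by auto

lemma ptime_le_mono: "j < n \<Longrightarrow> 0 \<le> t \<Longrightarrow> t \<le> u \<Longrightarrow> ptime I j u \<le> ptime I j t"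
  using valid unfolding valid_instance_def jobs_def by auto

lemma f_antimono: "j < n \<Longrightarrow> 0 < t \<Longrightarrow> t \<le> u \<Longrightarrow> f j u \<le> f j t"
  using ptime_le_mono[of j t u] by (simp add: ptime_eq)

lemma work_mono:
  assumes "j < n" "0 < t" "t \<le> u"
  shows "t * f j t \<le> u * f j u"
proof -
  have "ereal t * ptime I j t \<le> ereal u * ptime I j u"
    using valid assms unfolding valid_instance_def jobs_def by blast
  then show ?thesis using assms by (simp add: ptime_eq)
qed

lemma gamma_le: "j < n \<Longrightarrow> ptime I j (real (g j)) \<le> ereal C"
  using gamma_ex unfolding gamma_exists_def gamma_def jobs_def by (auto intro: LeastI_ex)

lemma gamma_pos: "j < n \<Longrightarrow> 0 < g j"
  using gamma_le[of j] ptime_0[of j] by (cases "g j") auto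

lemma gamma_minimal: "ptime I j (real q) \<le> ereal C \<Longrightarrow> g j \<le> q"
  unfolding gamma_def by (rule Least_le)

text \<open>Monotonicity turns the least threshold into a comparison, which is what makes a binary
  search with the oracle correct.\<close>

lemma f_le_C_iff:
  assumes "j < n" "0 < q"
  shows "f j (real q) \<le> C \<longleftrightarrow> g j \<le> q"
proof -
  have eq: "ptime I j (real q) = ereal (f j (real q))" using assms by (simp add: ptime_eq)
  show ?thesis
  proof
    assume "f j (real q) \<le> C"
    then show "g j \<le> q" by (intro gamma_minimal) (simp add: eq)
  next
    assume "g j \<le> q"
    then have "ptime I j (real q) \<le> ptime I j (real (g j))" using assms by (intro ptime_le_mono) auto
    also have "\<dots> \<le> ereal C" using assms by (intro gamma_le)
    finally show "f j (real q) \<le> C" by (simp add: eq)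
  qed
qed

lemma rspeed_pos: "j < n \<Longrightarrow> 0 < rspeed I C i j"
  using gamma_pos by (simp add: rspeed_def less_max_iff_disj)

lemma a_nonneg: "j < n \<Longrightarrow> 0 \<le> a i j"
  using f_nonneg rspeed_pos by (simp add: a_def)

lemma x_nonneg: "i < m \<Longrightarrow> j < n \<Longrightarrow> 0 \<le> x i j"
  and x_eq_0: "i < m \<Longrightarrow> j < n \<Longrightarrow> s i j = 0 \<Longrightarrow> x i j = 0"
  and x_sum: "j < n \<Longrightarrow> (\<Sum>i<m. x i j) = 1"
  using feasible unfolding lp_feasible_def jobs_def machines_def by auto

lemma load: "i < m \<Longrightarrow> (\<Sum>j<n. a i j * x i j) \<le> C"
proof -
  assume i: "i < m"
  have "(\<Sum>j\<in>{j\<in>jobs I. s i j \<noteq> 0}.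
           ptime I j (real (rspeed I C i j)) *
           ereal ((real (rspeed I C i j) / real (s i j)) powr p) * ereal (x i j))
     = (\<Sum>j\<in>{j\<in>jobs I. s i j \<noteq> 0}. ereal (a i j * x i j))"
    by (rule sum.cong) (auto simp: jobs_def ptime_eq rspeed_pos a_def)
  also have "\<dots> = ereal (\<Sum>j\<in>{j\<in>jobs I. s i j \<noteq> 0}. a i j * x i j)"
    by (simp add: sum_ereal)
  also have "(\<Sum>j\<in>{j\<in>jobs I. s i j \<noteq> 0}. a i j * x i j) = (\<Sum>j<n. a i j * x i j)"
    by (rule sum.mono_neutral_left) (auto simp: jobs_def a_def)
  finally have eq: "(\<Sum>j\<in>{j\<in>jobs I. s i j \<noteq> 0}.
           ptime I j (real (rspeed I C i j)) *
           ereal ((real (rspeed I C i j) / real (s i j)) powr p) * ereal (x i j))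
     = ereal (\<Sum>j<n. a i j * x i j)" .
  have "(\<Sum>j\<in>{j\<in>jobs I. s i j \<noteq> 0}.
           ptime I j (real (rspeed I C i j)) *
           ereal ((real (rspeed I C i j) / real (s i j)) powr p) * ereal (x i j)) \<le> ereal C"
    using feasible i unfolding lp_feasible_def machines_def by blast
  then show ?thesis unfolding eq by simp
qed

text \<open>Non-decreasing work bounds the time at speed \<open>s\<close> by the time at speed
  \<open>r\<close> multiplied by \<open>r / s\<close>, and \<open>r / s \<ge> 1\<close> absorbs the
  exponent \<open>p\<close>. So a job alone on a machine needs at most its LP coefficient.\<close>

lemma f_le_a:
  assumes "j < n" "0 < s i j"
  shows "f j (real (s i j)) \<le> a i j"
proof -
  let ?r = "real (rspeed I C i j)" and ?s = "real (s i j)"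
  have r: "?s \<le> ?r" "0 < ?s" using assms by (auto simp: rspeed_def)
  have "f j ?s \<le> f j ?r * (?r / ?s)"
    using work_mono[OF assms(1) r(2) r(1)] r by (simp add: field_simps)
  also have "\<dots> \<le> f j ?r * (?r / ?s) powr p"
  proof (rule mult_left_mono)
    show "?r / ?s \<le> (?r / ?s) powr p"
      using powr_mono[of 1 p "?r / ?s"] r reg by simp
  qed (use f_nonneg rspeed_pos assms in simp)
  finally show ?thesis using assms by (simp add: a_def)
qed

text \<open>A bound linear in the share \<open>X\<close>, so that it can be summed over a set of
  machines. Below the threshold it is \<open>a i j * X \<le> C\<close> solved for the speed;
  otherwise it follows from \<open>X \<le> 1\<close> and \<open>F \<le> C\<close>.\<close>

lemma speed_powr_ge:
  assumes j: "j < n" and "0 < s i j" and X: "0 \<le> X" "X \<le> 1" and aX: "a i j * X \<le> C"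
  shows "X * f j (real (g j)) * real (g j) powr p / C \<le> real (s i j) powr p"
proof -
  let ?F = "f j (real (g j))" and ?g = "real (g j)" and ?s = "real (s i j)"
  have pos: "0 < ?s" "0 < ?g" using assms gamma_pos by auto
  have F: "0 \<le> ?F" "?F \<le> C" using f_nonneg f_le_C_iff[of j "g j"] j pos by auto
  show ?thesis
  proof (cases "s i j < g j")
    case True
    then have "rspeed I C i j = g j" by (simp add: rspeed_def)
    then have "?F * (?g / ?s) powr p * X \<le> C" using aX assms by (simp add: a_def)
    then show ?thesis using pos C_pos by (simp add: powr_divide field_simps)
  next
    case False
    then have "?g powr p \<le> ?s powr p" using pos reg by (intro powr_mono2) auto
    moreover have "X * ?F \<le> C" using F X mult_mono[of X 1 ?F C] by simp
    ultimately have "X * ?F * ?g powr p \<le> C * ?s powr p"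
      using F X C_pos by (intro mult_mono) auto
    then show ?thesis using C_pos by (simp add: field_simps)
  qed
qed

text \<open>Writing \<open>F = f j (g j)\<close>, monotonicity of the work gives \<open>f \<sigma> \<le> F g / \<sigma>\<close>, and the claim
  reduces to \<open>(F / C) powr (p - 1) \<le> 1\<close>.\<close>

lemma ptime_split_le:
  assumes j: "j < n" and A: "finite A" and th: "0 < th" "th \<le> 1" "th \<le> (\<Sum>i\<in>A. X i)"
    and X: "\<And>i. i \<in> A \<Longrightarrow> 0 < s i j \<and> 0 \<le> X i \<and> X i \<le> 1 \<and> a i j * X i \<le> C"
  shows "ptime I j (eff_speed I j A) \<le> ereal ((1 / th) powr (1 / p) * C)"
proof -
  let ?F = "f j (real (g j))" and ?g = "real (g j)"
  define \<sigma> where "\<sigma> = eff_speed I j A"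
  define Q where "Q = (\<Sum>i\<in>A. real (s i j) powr p)"
  have g: "0 < ?g" using gamma_pos j by auto
  have F: "0 \<le> ?F" "?F \<le> C" using f_nonneg f_le_C_iff[of j "g j"] j g by auto
  have "A \<noteq> {}" using th by auto
  then have Q: "0 < Q" unfolding Q_def using A X by (intro sum_pos) auto
  have \<sigma>: "\<sigma> = Q powr (1 / p)" by (simp add: \<sigma>_def eff_speed_def Q_def)
  have \<sigma>_pos: "0 < \<sigma>" using Q by (simp add: \<sigma>)
  have \<sigma>_powr: "\<sigma> powr p = Q" using Q reg by (simp add: \<sigma> powr_powr)
  \<comment> \<open>Summing over \<open>A\<close>: the p-th power of the effective speed is at least
    the fraction \<open>th * F / C\<close> of \<open>g powr p\<close>.\<close>
  have "th * (?F * ?g powr p / C) \<le> (\<Sum>i\<in>A. X i) * (?F * ?g powr p / C)"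
    using th F C_pos by (intro mult_right_mono) auto
  also have "\<dots> = (\<Sum>i\<in>A. X i * ?F * ?g powr p / C)"
    by (simp add: sum_distrib_right sum_divide_distrib mult.assoc)
  also have "\<dots> \<le> Q" unfolding Q_def using X j by (intro sum_mono speed_powr_ge) auto
  finally have Q_ge: "th * (?F * ?g powr p / C) \<le> Q" .
  have one: "1 \<le> (1 / th) powr (1 / p)" using th reg by (intro ge_one_powr_ge_zero) auto
  have "f j \<sigma> \<le> (1 / th) powr (1 / p) * C"
  proof (cases "?g \<le> \<sigma>")
    case True
    then have "f j \<sigma> \<le> C" using f_antimono[OF j g True] F by simp
    also have "C \<le> (1 / th) powr (1 / p) * C" using one C_pos by simp
    finally show ?thesis .
  next
    case False
    then have le: "\<sigma> * f j \<sigma> \<le> ?g * ?F" using work_mono[OF j \<sigma>_pos] by simp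
    show ?thesis
    \<comment> \<open>The second case cancels the factor \<open>F\<close>.\<close>
    proof (cases "?F = 0")
      case True
      then have "f j \<sigma> \<le> 0" using le \<sigma>_pos by (simp add: mult_le_0_iff)
      then show ?thesis using C_pos by (meson less_eq_real_def mult_nonneg_nonneg order_trans powr_ge_zero)
    next
      case False
      then have Fp: "0 < ?F" using F by simp
      have "(f j \<sigma> * \<sigma>) powr p \<le> (?g * ?F) powr p"
        using le reg f_nonneg[OF j \<sigma>_pos] \<sigma>_pos by (intro powr_mono2) (auto simp: mult.commute)
      then have "f j \<sigma> powr p * Q \<le> ?g powr p * ?F powr p"
        using \<sigma>_pos g F f_nonneg[OF j \<sigma>_pos] by (simp add: powr_mult \<sigma>_powr)
      moreover have "f j \<sigma> powr p * (th * (?F * ?g powr p / C)) \<le> f j \<sigma> powr p * Q"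
        using Q_ge by (intro mult_left_mono) auto
      ultimately have "f j \<sigma> powr p * (th * (?F * ?g powr p / C)) \<le> ?g powr p * ?F powr p" by linarith
      then have "?g powr p * ?F * (f j \<sigma> powr p * th / C) \<le> ?g powr p * ?F * ?F powr (p - 1)"
        using Fp by (simp add: powr_diff mult_ac)
      then have "f j \<sigma> powr p * th / C \<le> ?F powr (p - 1)"
        using Fp g by (subst (asm) mult_le_cancel_left_pos) auto
      also have "\<dots> \<le> C powr (p - 1)" using F reg by (intro powr_mono2) auto
      finally have "f j \<sigma> powr p \<le> (1 / th) * C powr p"
        using C_pos th by (simp add: powr_diff field_simps)
      then have "(f j \<sigma> powr p) powr (1 / p) \<le> ((1 / th) * C powr p) powr (1 / p)"
        using reg by (intro powr_mono2) auto
      then show ?thesis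
        using reg C_pos th f_nonneg[OF j \<sigma>_pos]
          powr_mult[of "1 / th" "C powr p" "1 / p"] by (simp add: powr_powr)
    qed
  qed
  then show ?thesis using ptime_eq[OF j \<sigma>_pos] by (simp add: \<sigma>_def)
qed

text \<open>The thresholds are not part of the input, so this bound is what makes the search for them
  polynomial: since \<open>f j (g j) \<ge> C / 2\<close> unless \<open>g j = 1\<close>, a machine with \<open>x i j \<ge> 1 / m\<close> cannot be
  much slower than \<open>g j\<close>.\<close>

lemma gamma_bound:
  assumes j: "j < n"
  shows "\<exists>i<m. g j \<le> 2 * m * s i j"
proof -
  \<comment> \<open>The \<open>m\<close> shares of \<open>j\<close> sum to 1, so one of them is at
    least \<open>1 / m\<close>.\<close>
  have "\<exists>i<m. 1 \<le> real m * x i j"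
  proof (rule ccontr)
    assume "\<not> ?thesis"
    then have lt: "\<And>i. i < m \<Longrightarrow> real m * x i j < 1" by auto
    have "m \<noteq> 0" using x_sum[OF j] by (intro notI) simp
    then have "(\<Sum>i<m. real m * x i j) < (\<Sum>i<m. 1)" using lt by (intro sum_strict_mono) auto
    then show False using x_sum[OF j] by (simp flip: sum_distrib_left)
  qed
  then obtain i where i: "i < m" "1 \<le> real m * x i j" by blast
  then have s: "0 < s i j" using x_eq_0[of i j] j by (cases "s i j") auto
  show ?thesis
  proof (cases "g j \<le> s i j")
    case True
    also have "s i j \<le> 2 * m * s i j" using i by auto
    finally show ?thesis using i by blast
  next
    case False
    let ?F = "f j (real (g j))" and ?q = "real (g j) / real (s i j)"
    have q: "1 \<le> ?q" using False s by simp
    have r: "rspeed I C i j = g j" using False by (simp add: rspeed_def)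
    have F: "C / 2 \<le> ?F"
    proof -
      \<comment> \<open>Here \<open>g j \<ge> 2\<close>, so \<open>k \<ge> g j / 2\<close>.
        Minimality gives \<open>f j k > C\<close>, and monotone work carries this over to
        \<open>g j\<close> with a loss of at most a factor 2.\<close>
      define k where "k = g j - 1"
      have k: "0 < k" "g j = Suc k" using False s by (auto simp: k_def)
      then have "C < f j (real k)" using f_le_C_iff[OF j, of k] by auto
      then have "real k * C < real k * f j (real k)" using k by simp
      also have "\<dots> \<le> real (g j) * ?F" using k by (intro work_mono j) auto
      finally have "real k * C \<le> real (g j) * ?F" by simp
      moreover have "real (g j) * (C / 2) \<le> real k * C" using k C_pos by (simp add: field_simps)
      ultimately have "real (g j) * (C / 2) \<le> real (g j) * ?F" by linarith
      then show ?thesis using k by (simp add: mult_le_cancel_left)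
    qed
    have "a i j * x i j \<le> (\<Sum>j<n. a i j * x i j)"
      using j i by (intro member_le_sum) (auto intro!: mult_nonneg_nonneg a_nonneg x_nonneg)
    also have "\<dots> \<le> C" using load i by blast
    finally have ax: "a i j * x i j \<le> C" .
    \<comment> \<open>The coefficient \<open>a i j\<close> is squeezed between
      \<open>C / 2 * q\<close> and \<open>m * C\<close>, which bounds \<open>q\<close>.\<close>
    have "C / 2 * ?q \<le> ?F * ?q powr p"
      using F C_pos q powr_mono[of 1 p ?q] reg by (intro mult_mono) auto
    also have "\<dots> = a i j" using s r by (simp add: a_def)
    also have "a i j \<le> a i j * (real m * x i j)" using a_nonneg[OF j, of i] i mult_left_mono[of 1 "real m * x i j" "a i j"] by simp
    also have "\<dots> \<le> real m * C" using ax mult_left_mono[OF ax, of "real m"] by (simp add: mult_ac)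
    finally have "2 * (C / 2 * ?q) \<le> 2 * (real m * C)" by simp
    then have "C * ?q \<le> C * (2 * real m)" by (simp only: mult_ac)
    then have "?q \<le> 2 * real m" using C_pos by (subst (asm) mult_le_cancel_left_pos)
    then have "real (g j) \<le> 2 * real m * real (s i j)" using s by (simp add: pos_divide_le_eq)
    then have "real (g j) \<le> real (2 * m * s i j)" by simp
    then show ?thesis using i of_nat_le_iff by blast
  qed
qed

end


section \<open>Total correctness with step bounds\<close>

text \<open>As executions are deterministic, the existence of one execution is total correctness.
  The step count is only bounded from above, so that branches of different length can share a
  bound.\<close>

definition run :: "oracle_fun \<Rightarrow> com \<Rightarrow> state \<Rightarrow> nat \<Rightarrow> (state \<Rightarrow> bool) \<Rightarrow> bool" where
  "run orc c \<sigma> B P \<longleftrightarrow> (\<exists>t \<sigma>'. exec orc c \<sigma> t \<sigma>' \<and> t \<le> B \<and> P \<sigma>')"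

lemma run_mono: "run orc c \<sigma> B P \<Longrightarrow> (\<And>\<sigma>'. P \<sigma>' \<Longrightarrow> Q \<sigma>') \<Longrightarrow> B \<le> B' \<Longrightarrow> run orc c \<sigma> B' Q"
  unfolding run_def by (meson order_trans)

lemma run_Skip: "P \<sigma> \<Longrightarrow> 1 \<le> B \<Longrightarrow> run orc Skip \<sigma> B P"
  unfolding run_def using exec.Skip by blast

lemma run_NAssign:
  "P (\<sigma>\<lparr>nmem := upd2 (nmem \<sigma>) a (nval \<sigma> e1) (nval \<sigma> e2) (nval \<sigma> e)\<rparr>) \<Longrightarrow> 1 \<le> B \<Longrightarrow>
   run orc (NAssign a e1 e2 e) \<sigma> B P"
  unfolding run_def using exec.NAssign by blast

lemma run_RAssign:
  "P (\<sigma>\<lparr>rmem := upd2 (rmem \<sigma>) a (nval \<sigma> e1) (nval \<sigma> e2) (rval orc \<sigma> e)\<rparr>) \<Longrightarrow> 1 \<le> B \<Longrightarrow>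
   run orc (RAssign a e1 e2 e) \<sigma> B P"
  unfolding run_def using exec.RAssign by blast

lemma run_Seq:
  assumes "run orc c1 \<sigma> B1 Q" "\<And>\<sigma>'. Q \<sigma>' \<Longrightarrow> run orc c2 \<sigma>' B2 P"
  shows "run orc (Seq c1 c2) \<sigma> (B1 + B2) P"
proof -
  obtain t1 \<sigma>1 where 1: "exec orc c1 \<sigma> t1 \<sigma>1" "t1 \<le> B1" "Q \<sigma>1" using assms(1) unfolding run_def by blast
  obtain t2 \<sigma>2 where 2: "exec orc c2 \<sigma>1 t2 \<sigma>2" "t2 \<le> B2" "P \<sigma>2" using assms(2)[OF 1(3)] unfolding run_def by blast
  show ?thesis unfolding run_def using exec.Seq[OF 1(1) 2(1)] 1 2 add_mono by blast
qed

lemma run_Seq_NAssign: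
  assumes "run orc c (\<sigma>\<lparr>nmem := upd2 (nmem \<sigma>) a (nval \<sigma> e1) (nval \<sigma> e2) (nval \<sigma> e)\<rparr>) B P"
  shows "run orc (Seq (NAssign a e1 e2 e) c) \<sigma> (Suc B) P"
  using run_Seq[OF run_NAssign[of "\<lambda>\<sigma>'. \<sigma>' = \<sigma>\<lparr>nmem := upd2 (nmem \<sigma>) a (nval \<sigma> e1) (nval \<sigma> e2) (nval \<sigma> e)\<rparr>" _ _ _ _ _ 1]] assms
  by fastforce

lemma run_Seq_RAssign:
  assumes "run orc c (\<sigma>\<lparr>rmem := upd2 (rmem \<sigma>) a (nval \<sigma> e1) (nval \<sigma> e2) (rval orc \<sigma> e)\<rparr>) B P"
  shows "run orc (Seq (RAssign a e1 e2 e) c) \<sigma> (Suc B) P"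
  using run_Seq[OF run_RAssign[of "\<lambda>\<sigma>'. \<sigma>' = \<sigma>\<lparr>rmem := upd2 (rmem \<sigma>) a (nval \<sigma> e1) (nval \<sigma> e2) (rval orc \<sigma> e)\<rparr>" _ _ _ _ _ _ 1]] assms
  by fastforce

lemma run_Cond:
  assumes "bval orc \<sigma> b \<Longrightarrow> run orc c1 \<sigma> B P" "\<not> bval orc \<sigma> b \<Longrightarrow> run orc c2 \<sigma> B P"
  shows "run orc (Cond b c1 c2) \<sigma> (Suc B) P"
proof (cases "bval orc \<sigma> b")
  case True
  then obtain t \<sigma>' where "exec orc c1 \<sigma> t \<sigma>'" "t \<le> B" "P \<sigma>'" using assms(1) unfolding run_def by blast
  then show ?thesis unfolding run_def using exec.CondTrue[OF True] by fastforce
next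
  case False
  then obtain t \<sigma>' where "exec orc c2 \<sigma> t \<sigma>'" "t \<le> B" "P \<sigma>'" using assms(2) unfolding run_def by blast
  then show ?thesis unfolding run_def using exec.CondFalse[OF False] by fastforce
qed

text \<open>The variant bounds the number of rounds; each costs a test and at most \<open>B\<close>
  steps, and the failing test costs one more.\<close>

lemma run_While:
  fixes V :: "state \<Rightarrow> nat"
  assumes "J \<sigma>"
    and step: "\<And>\<sigma>. J \<sigma> \<Longrightarrow> bval orc \<sigma> b \<Longrightarrow> run orc c \<sigma> B (\<lambda>\<sigma>'. J \<sigma>' \<and> V \<sigma>' < V \<sigma>)"
    and "V \<sigma> \<le> K"
  shows "run orc (While b c) \<sigma> (Suc (K * Suc B)) (\<lambda>\<sigma>'. J \<sigma>' \<and> \<not> bval orc \<sigma>' b)"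
  using assms(1,3)
proof (induction K arbitrary: \<sigma>)
  case 0
  then have "\<not> bval orc \<sigma> b" using step unfolding run_def by fastforce
  from exec.WhileFalse[OF this] show ?case using 0 \<open>\<not> bval orc \<sigma> b\<close> unfolding run_def by fastforce
next
  case (Suc K)
  show ?case
  proof (cases "bval orc \<sigma> b")
    case True
    then obtain t1 \<sigma>1 where 1: "exec orc c \<sigma> t1 \<sigma>1" "t1 \<le> B" "J \<sigma>1" "V \<sigma>1 < V \<sigma>"
      using step[OF Suc.prems(1)] unfolding run_def by blast
    then have "V \<sigma>1 \<le> K" using Suc.prems by simp
    from Suc.IH[OF 1(3) this] obtain t2 \<sigma>2 where
      2: "exec orc (While b c) \<sigma>1 t2 \<sigma>2" "t2 \<le> Suc (K * Suc B)" "J \<sigma>2" "\<not> bval orc \<sigma>2 b"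
      unfolding run_def by blast
    from exec.WhileTrue[OF True 1(1) 2(1)] show ?thesis using 1 2 unfolding run_def by fastforce
  next
    case False
    from exec.WhileFalse[OF this] show ?thesis using Suc.prems False unfolding run_def by fastforce
  qed
qed

section \<open>Counting loops, flexible step bounds and untouched arrays\<close>

abbreviation NVar :: "string \<Rightarrow> nexp" where "NVar a \<equiv> NCell a (NConst 0) (NConst 0)"
abbreviation RVar :: "string \<Rightarrow> rexp" where "RVar a \<equiv> RCell a (NConst 0) (NConst 0)"
abbreviation NSet :: "string \<Rightarrow> nexp \<Rightarrow> com" where "NSet a e \<equiv> NAssign a (NConst 0) (NConst 0) e"
abbreviation RSet :: "string \<Rightarrow> rexp \<Rightarrow> com" where "RSet a e \<equiv> RAssign a (NConst 0) (NConst 0) e"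

definition For :: "string \<Rightarrow> nexp \<Rightarrow> com \<Rightarrow> com" where
  "For i e c = Seq (NSet i (NConst 0))
     (While (NLess (NVar i) e) (Seq c (NSet i (NAdd (NVar i) (NConst 1)))))"

text \<open>The body must leave the counter alone. The overhead is a test and an increment per
  round, plus the initialisation and the failing test.\<close>

lemma run_For:
  assumes init: "J 0 (\<sigma>\<lparr>nmem := upd2 (nmem \<sigma>) i 0 0 0\<rparr>)"
    and inv: "\<And>k \<sigma>. J k \<sigma> \<Longrightarrow> k \<le> K \<Longrightarrow> nmem \<sigma> i 0 0 = k \<and> nval \<sigma> e = K"
    and step: "\<And>k \<sigma>. J k \<sigma> \<Longrightarrow> k < K \<Longrightarrow>
      run orc c \<sigma> B (\<lambda>\<sigma>'. J (Suc k) (\<sigma>'\<lparr>nmem := upd2 (nmem \<sigma>') i 0 0 (Suc k)\<rparr>) \<and> nmem \<sigma>' i 0 0 = k)"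
  shows "run orc (For i e c) \<sigma> (2 + K * (B + 2)) (J K)"
proof -
  let ?b = "NLess (NVar i) e" and ?c = "Seq c (NSet i (NAdd (NVar i) (NConst 1)))"
  let ?J = "\<lambda>\<sigma>. \<exists>k\<le>K. J k \<sigma>" and ?V = "\<lambda>\<sigma>. K - nmem \<sigma> i 0 0"
  have "run orc (While ?b ?c) (\<sigma>\<lparr>nmem := upd2 (nmem \<sigma>) i 0 0 0\<rparr>) (Suc (K * Suc (B + 1)))
     (\<lambda>\<sigma>'. ?J \<sigma>' \<and> \<not> bval orc \<sigma>' ?b)"
  proof (rule run_While)
    fix \<sigma> assume "?J \<sigma>" and b: "bval orc \<sigma> ?b"
    then obtain k where k: "k \<le> K" "J k \<sigma>" by blast
    then have eqs: "nmem \<sigma> i 0 0 = k" "nval \<sigma> e = K" using inv by blast+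
    then have "k < K" using b by simp
    from step[OF k(2) this]
    show "run orc ?c \<sigma> (B + 1) (\<lambda>\<sigma>'. ?J \<sigma>' \<and> ?V \<sigma>' < ?V \<sigma>)"
    proof (rule run_Seq)
      fix \<sigma>1 assume 1: "J (Suc k) (\<sigma>1\<lparr>nmem := upd2 (nmem \<sigma>1) i 0 0 (Suc k)\<rparr>) \<and> nmem \<sigma>1 i 0 0 = k"
      then have "nmem (\<sigma>1\<lparr>nmem := upd2 (nmem \<sigma>1) i 0 0 (Suc k)\<rparr>) i 0 0 = Suc k"
        by (simp add: upd2_def)
      then show "run orc (NSet i (NAdd (NVar i) (NConst 1))) \<sigma>1 1 (\<lambda>\<sigma>'. ?J \<sigma>' \<and> ?V \<sigma>' < ?V \<sigma>)"
        using 1 \<open>k < K\<close> eqs by (intro run_NAssign) (auto intro!: exI[of _ "Suc k"])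
    qed
  qed (use init in auto)
  then have "run orc (For i e c) \<sigma> (1 + Suc (K * Suc (B + 1))) (\<lambda>\<sigma>'. ?J \<sigma>' \<and> \<not> bval orc \<sigma>' ?b)"
    unfolding For_def by (auto intro: run_Seq_NAssign)
  then show ?thesis
  proof (rule run_mono)
    fix \<sigma>' assume *: "?J \<sigma>' \<and> \<not> bval orc \<sigma>' ?b"
    then obtain k where "k \<le> K" "J k \<sigma>'" by blast
    then show "J K \<sigma>'" using inv[of k \<sigma>'] * by (cases "k = K") auto
  qed simp
qed

lemma upd2_same: "upd2 h a k l v a = (h a)(k := (h a k)(l := v))"
  and upd2_other: "b \<noteq> a \<Longrightarrow> upd2 h a k l v b = h b"
  by (auto simp: upd2_def)

text \<open>The variants ending in \<open>_le\<close> accept any bound in the goal, so that the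
  arithmetic of step counts is left to side conditions.\<close>

lemma run_Seq_le:
  assumes "run orc c1 \<sigma> M Q" "\<And>\<sigma>'. Q \<sigma>' \<Longrightarrow> run orc c2 \<sigma>' N P" "M + N \<le> B"
  shows "run orc (Seq c1 c2) \<sigma> B P"
  using run_mono[OF run_Seq[OF assms(1,2)]] assms(3) by blast

lemma run_Seq_NAssign_le:
  assumes "run orc c (\<sigma>\<lparr>nmem := upd2 (nmem \<sigma>) a (nval \<sigma> e1) (nval \<sigma> e2) (nval \<sigma> e)\<rparr>) (B - 1) P" "1 \<le> B"
  shows "run orc (Seq (NAssign a e1 e2 e) c) \<sigma> B P"
  using run_mono[OF run_Seq_NAssign[OF assms(1)], of P B] assms(2) by simp

lemma run_Seq_RAssign_le:
  assumes "run orc c (\<sigma>\<lparr>rmem := upd2 (rmem \<sigma>) a (nval \<sigma> e1) (nval \<sigma> e2) (rval orc \<sigma> e)\<rparr>) (B - 1) P" "1 \<le> B"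
  shows "run orc (Seq (RAssign a e1 e2 e) c) \<sigma> B P"
  using run_mono[OF run_Seq_RAssign[OF assms(1)], of P B] assms(2) by simp

lemma run_Cond_le:
  assumes "bval orc \<sigma> b \<Longrightarrow> run orc c1 \<sigma> (B - 1) P" "\<not> bval orc \<sigma> b \<Longrightarrow> run orc c2 \<sigma> (B - 1) P" "1 \<le> B"
  shows "run orc (Cond b c1 c2) \<sigma> B P"
  using run_mono[OF run_Cond[OF assms(1,2)], where Q = P and B' = B] assms(3) by simp

text \<open>\<open>NS\<close> and \<open>RS\<close> list the arrays that may be written; all others
  are carried across a subprogram as a whole.\<close>

definition frame :: "string set \<Rightarrow> string set \<Rightarrow> state \<Rightarrow> state \<Rightarrow> bool" where
  "frame NS RS \<sigma> \<sigma>' \<longleftrightarrow>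
     (\<forall>a. a \<notin> NS \<longrightarrow> nmem \<sigma>' a = nmem \<sigma> a) \<and> (\<forall>a. a \<notin> RS \<longrightarrow> rmem \<sigma>' a = rmem \<sigma> a)"

lemma frame_refl [simp]: "frame NS RS \<sigma> \<sigma>"
  by (simp add: frame_def)

lemma frame_trans:
  "frame NS RS \<sigma> \<sigma>1 \<Longrightarrow> frame NS' RS' \<sigma>1 \<sigma>2 \<Longrightarrow> NS' \<subseteq> NS \<Longrightarrow> RS' \<subseteq> RS \<Longrightarrow> frame NS RS \<sigma> \<sigma>2"
  unfolding frame_def by (metis subsetD)

lemma frame_mono: "frame NS' RS' \<sigma> \<sigma>' \<Longrightarrow> NS' \<subseteq> NS \<Longrightarrow> RS' \<subseteq> RS \<Longrightarrow> frame NS RS \<sigma> \<sigma>'"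
  unfolding frame_def by blast

lemma frame_nmem: "frame NS RS \<sigma> \<sigma>' \<Longrightarrow> a \<notin> NS \<Longrightarrow> nmem \<sigma>' a = nmem \<sigma> a"
  and frame_rmem: "frame NS RS \<sigma> \<sigma>' \<Longrightarrow> a \<notin> RS \<Longrightarrow> rmem \<sigma>' a = rmem \<sigma> a"
  by (simp_all add: frame_def)

lemma frame_nmem_upd [simp]:
  "a \<in> NS \<Longrightarrow> frame NS RS \<sigma> (\<sigma>'\<lparr>nmem := upd2 h a k l v\<rparr>) \<longleftrightarrow> frame NS RS \<sigma> (\<sigma>'\<lparr>nmem := h\<rparr>)"
  and frame_rmem_upd [simp]:
  "a \<in> RS \<Longrightarrow> frame NS RS \<sigma> (\<sigma>'\<lparr>rmem := upd2 h' a k l w\<rparr>) \<longleftrightarrow> frame NS RS \<sigma> (\<sigma>'\<lparr>rmem := h'\<rparr>)"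
  by (auto simp: frame_def upd2_def)

declare upd2_same [simp] upd2_other [simp]


section \<open>Computing the thresholds\<close>

text \<open>Doubling followed by a binary search over the stored powers of two, as naturals cannot be
  halved in one step.  The invariant of the second loop is \<open>q < g j \<le> q + 2 ^ k\<close>.\<close>

definition gamma_com :: com where
  "gamma_com =
   Seq (NSet ''k'' (NConst 0))
  (Seq (NAssign ''pw'' (NConst 0) (NConst 0) (NConst 1))
  (Seq (While (RLess (RVar ''C'') (ROracle (NVar ''j'') (ROf (NCell ''pw'' (NVar ''k'') (NConst 0)))))
         (Seq (NAssign ''pw'' (NAdd (NVar ''k'') (NConst 1)) (NConst 0)
                 (NAdd (NCell ''pw'' (NVar ''k'') (NConst 0)) (NCell ''pw'' (NVar ''k'') (NConst 0))))
              (NSet ''k'' (NAdd (NVar ''k'') (NConst 1)))))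
  (Seq (NSet ''q'' (NConst 0))
  (Seq (While (NLess (NConst 0) (NVar ''k''))
         (Seq (NSet ''k'' (NSub (NVar ''k'') (NConst 1)))
              (Cond (RLess (RVar ''C'')
                      (ROracle (NVar ''j'') (ROf (NAdd (NVar ''q'') (NCell ''pw'' (NVar ''k'') (NConst 0))))))
                 (NSet ''q'' (NAdd (NVar ''q'') (NCell ''pw'' (NVar ''k'') (NConst 0))))
                 Skip)))
       (NAssign ''g'' (NVar ''j'') (NConst 0) (NAdd (NVar ''q'') (NConst 1)))))))"

context lp_solution
begin

text \<open>\<open>gamma_bound\<close> combined with \<open>m < 2 ^ m\<close> and the bit length of
  the speed, both of which are counted in the input size. Hence both searches take linearly many
  rounds.\<close>

lemma gamma_le_power: "j < n \<Longrightarrow> g j \<le> 2 ^ Suc (input_size I)"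
proof -
  assume j: "j < n"
  obtain i where i: "i < m" "g j \<le> 2 * m * s i j" using gamma_bound[OF j] by blast
  have "1 + floorlog 2 (s i j) \<le> (\<Sum>j\<in>jobs I. 1 + floorlog 2 (s i j))"
    using j by (intro member_le_sum) (auto simp: jobs_def)
  also have "\<dots> \<le> (\<Sum>i\<in>machines I. \<Sum>j\<in>jobs I. 1 + floorlog 2 (s i j))"
    using i by (intro member_le_sum[where f = "\<lambda>i. \<Sum>j\<in>jobs I. 1 + floorlog 2 (s i j)"]) (auto simp: machines_def)
  finally have size: "m + floorlog 2 (s i j) \<le> input_size I" unfolding input_size_def by linarith
  have "s i j < 2 ^ floorlog 2 (s i j)" 
    using floorlog_bounds[of "s i j" 2] by (cases "s i j = 0") auto
  then have "m * s i j \<le> 2 ^ m * 2 ^ floorlog 2 (s i j)"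
    using less_exp[of m] by (intro mult_mono) auto
  also have "\<dots> \<le> 2 ^ input_size I" using size by (simp flip: power_add)
  finally show ?thesis using i by simp
qed

lemma run_gamma_com:
  assumes j: "nmem \<sigma> ''j'' 0 0 = j" "j < n" and C: "rmem \<sigma> ''C'' 0 0 = C"
  shows "run f gamma_com \<sigma> (12 * input_size I + 20)
    (\<lambda>\<sigma>'. frame {''k'', ''pw'', ''q'', ''g''} {} \<sigma> \<sigma>' \<and> nmem \<sigma>' ''g'' j 0 = g j)"
proof -
  define K where "K = Suc (input_size I)"
  have gK: "g j \<le> 2 ^ K" unfolding K_def using gamma_le_power j by blast
  let ?F = "\<lambda>\<sigma>'. frame {''k'', ''pw'', ''q'', ''g''} {} \<sigma> \<sigma>'"
  have F: "nmem \<sigma>' ''j'' 0 0 = j" "rmem \<sigma>' ''C'' 0 0 = C" if "?F \<sigma>'" for \<sigma>'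
    using that j C by (simp_all add: frame_def)
  let ?J = "\<lambda>\<sigma>'. ?F \<sigma>' \<and> nmem \<sigma>' ''k'' 0 0 \<le> K \<and> (\<forall>t\<le>nmem \<sigma>' ''k'' 0 0. nmem \<sigma>' ''pw'' t 0 = 2 ^ t)"
  let ?I = "\<lambda>\<sigma>'. ?J \<sigma>' \<and> nmem \<sigma>' ''q'' 0 0 < g j \<and> g j \<le> nmem \<sigma>' ''q'' 0 0 + 2 ^ nmem \<sigma>' ''k'' 0 0"
  \<comment> \<open>Only positive speeds are queried; at speed 0 the oracle would answer 0 instead
    of \<open>\<infinity>\<close>.\<close>
  have test: "C < f j (real q) \<longleftrightarrow> q < g j" if "0 < q" for q
    using f_le_C_iff[OF j(2) that] by auto
  show ?thesis
    unfolding gamma_com_def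
  proof (intro run_Seq_NAssign_le, rule run_Seq_le[where M = "Suc (K * Suc 2)" and N = "8 + K * 4"],
      rule run_While[where J = ?J and K = K and V = "\<lambda>\<sigma>. K - nmem \<sigma> ''k'' 0 0" and B = 2], goal_cases)
    case (2 \<sigma>')
    then have "2 ^ nmem \<sigma>' ''k'' 0 0 < g j" using F[of \<sigma>'] test[of "2 ^ nmem \<sigma>' ''k'' 0 0"] by auto
    then have "(2::nat) ^ nmem \<sigma>' ''k'' 0 0 < 2 ^ K" using gK by linarith
    then have "nmem \<sigma>' ''k'' 0 0 < K" by simp
    then show ?case
      using 2 by (intro run_Seq_NAssign_le run_NAssign) (auto simp: le_Suc_eq)
  next
    case (4 \<sigma>')
    then have J: "?J \<sigma>'" and "\<not> 2 ^ nmem \<sigma>' ''k'' 0 0 < g j"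
      using F[of \<sigma>'] test[of "2 ^ nmem \<sigma>' ''k'' 0 0"] by auto
    show ?case
    proof (rule run_Seq_NAssign_le, rule run_Seq_le[where M = "Suc (K * Suc 3)" and N = 1],
        rule run_While[where J = ?I and K = K and V = "\<lambda>\<sigma>. nmem \<sigma> ''k'' 0 0" and B = 3], goal_cases)
      case 1
      then show ?case using J \<open>\<not> 2 ^ nmem \<sigma>' ''k'' 0 0 < g j\<close> gamma_pos[OF j(2)] by simp
    next
      case (2 \<sigma>1)
      then obtain k where k: "nmem \<sigma>1 ''k'' 0 0 = Suc k" by (cases "nmem \<sigma>1 ''k'' 0 0") auto
      define q where "q = nmem \<sigma>1 ''q'' 0 0"
      show ?case
        using 2 F[of \<sigma>1] k test[of "q + 2 ^ k"]
        by (intro run_Seq_NAssign_le run_Cond_le run_NAssign run_Skip) (auto simp flip: q_def)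
    next
      \<comment> \<open>At \<open>k = 0\<close> the invariant reads
        \<open>q < g j \<le> q + 1\<close>.\<close>
      case (4 \<sigma>1)
      then show ?case using F[of \<sigma>1] by (intro run_NAssign) auto
    qed (use J in simp_all)
  qed (simp_all add: K_def)
qed

end


section \<open>Setting up the bipartite graph\<close>

abbreviation NAt :: "string \<Rightarrow> nexp \<Rightarrow> nexp" where "NAt a e \<equiv> NCell a e (NConst 0)"
abbreviation RAt :: "string \<Rightarrow> nexp \<Rightarrow> rexp" where "RAt a e \<equiv> RCell a e (NConst 0)"
abbreviation NArr :: "string \<Rightarrow> nexp \<Rightarrow> nexp \<Rightarrow> com" where "NArr a e e' \<equiv> NAssign a e (NConst 0) e'"
abbreviation RArr :: "string \<Rightarrow> nexp \<Rightarrow> rexp \<Rightarrow> com" where "RArr a e e' \<equiv> RAssign a e (NConst 0) e'"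
abbreviation machine_vertex :: nexp where "machine_vertex \<equiv> NAdd (NVar ''n'') (NVar ''i'')"

definition coef_com :: com where
  "coef_com =
   Seq (Cond (NLess (NConst 0) (NCell ''s'' (NVar ''i'') (NVar ''j'')))
     (Seq (NSet ''r'' (NCell ''s'' (NVar ''i'') (NVar ''j'')))
     (Seq (Cond (NLess (NVar ''r'') (NAt ''g'' (NVar ''j''))) (NSet ''r'' (NAt ''g'' (NVar ''j''))) Skip)
          (RAssign ''c'' machine_vertex (NVar ''j'')
             (RMul (ROracle (NVar ''j'') (ROf (NVar ''r'')))
                (RExp (RMul (RVar ''p'')
                  (RLn (RDiv (ROf (NVar ''r'')) (ROf (NCell ''s'' (NVar ''i'') (NVar ''j'')))))))))))
     Skip)
  (Seq (RAssign ''c'' (NVar ''j'') machine_vertex (ROf (NConst 1)))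
  (Seq (RAssign ''X'' machine_vertex (NVar ''j'') (RCell ''x'' (NVar ''i'') (NVar ''j'')))
       (RAssign ''X'' (NVar ''j'') machine_vertex (RCell ''x'' (NVar ''i'') (NVar ''j'')))))"

definition setup_com :: com where
  "setup_com = For ''j'' (NVar ''n'') (Seq gamma_com (For ''i'' (NVar ''m'') coef_com))"

context lp_solution
begin

text \<open>In the graph, job \<open>j\<close> is the vertex \<open>j\<close> and machine \<open>i\<close> the vertex \<open>n + i\<close>.\<close>

definition coef :: "(nat \<times> nat) set \<Rightarrow> nat \<Rightarrow> nat \<Rightarrow> real" where
  "coef D u v =
     (if n \<le> u \<and> v < n \<and> (u - n, v) \<in> D then a (u - n) v
      else if u < n \<and> n \<le> v \<and> (v - n, u) \<in> D then 1 else 0)"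

definition sol :: "(nat \<times> nat) set \<Rightarrow> nat \<Rightarrow> nat \<Rightarrow> real" where
  "sol D u v =
     (if n \<le> u \<and> v < n \<and> (u - n, v) \<in> D then x (u - n) v
      else if u < n \<and> n \<le> v \<and> (v - n, u) \<in> D then x (v - n) u else 0)"

text \<open>Matches the two cells of \<open>c\<close> that belong to one pair: the LP coefficient in
  the row of the machine, 1 in the row of the job.\<close>

lemma coef_insert:
  "j < n \<Longrightarrow> coef (insert (i, j) D) = (coef D)(n + i := (coef D (n + i))(j := a i j),
     j := (coef D j)(n + i := 1))"
proof (intro ext)
  fix u v assume "j < n"
  show "coef (insert (i, j) D) u v = ((coef D)(n + i := (coef D (n + i))(j := a i j),
     j := (coef D j)(n + i := 1))) u v"
  proof (cases "n \<le> u")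
    case True
    then have "u - n = i \<longleftrightarrow> u = n + i" "u \<noteq> j" using \<open>j < n\<close> by auto
    then show ?thesis using True \<open>j < n\<close> by (auto simp: coef_def)
  next
    case False
    then have "n \<le> v \<Longrightarrow> v - n = i \<longleftrightarrow> v = n + i" by auto
    then show ?thesis using False by (cases "n \<le> v") (auto simp: coef_def)
  qed
qed

lemma sol_insert:
  "j < n \<Longrightarrow> sol (insert (i, j) D) = (sol D)(n + i := (sol D (n + i))(j := x i j),
     j := (sol D j)(n + i := x i j))"
proof (intro ext)
  fix u v assume "j < n"
  show "sol (insert (i, j) D) u v = ((sol D)(n + i := (sol D (n + i))(j := x i j),
     j := (sol D j)(n + i := x i j))) u v"
  proof (cases "n \<le> u")
    case True
    then have "u - n = i \<longleftrightarrow> u = n + i" "u \<noteq> j" using \<open>j < n\<close> by auto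
    then show ?thesis using True \<open>j < n\<close> by (auto simp: sol_def)
  next
    case False
    then have "n \<le> v \<Longrightarrow> v - n = i \<longleftrightarrow> v = n + i" by auto
    then show ?thesis using False by (cases "n \<le> v") (auto simp: sol_def)
  qed
qed

abbreviation "\<sigma>\<^sub>0 \<equiv> input_state I C x"

lemma input_nmem [simp]: "nmem \<sigma>\<^sub>0 ''n'' 0 0 = n" "nmem \<sigma>\<^sub>0 ''m'' 0 0 = m"
    "i < m \<Longrightarrow> j < n \<Longrightarrow> nmem \<sigma>\<^sub>0 ''s'' i j = s i j"
  and input_rmem [simp]: "rmem \<sigma>\<^sub>0 ''p'' 0 0 = p" "rmem \<sigma>\<^sub>0 ''C'' 0 0 = C"
    "i < m \<Longrightarrow> j < n \<Longrightarrow> rmem \<sigma>\<^sub>0 ''x'' i j = x i j"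
  by (simp_all add: input_state_def jobs_def machines_def)

abbreviation "setup_frame \<equiv> frame {''i'', ''j'', ''k'', ''pw'', ''q'', ''g'', ''r''} {''c'', ''X''} \<sigma>\<^sub>0"

definition setup_inv :: "(nat \<times> nat) set \<Rightarrow> state \<Rightarrow> bool" where
  "setup_inv D \<sigma> \<longleftrightarrow> setup_frame \<sigma> \<and> rmem \<sigma> ''c'' = coef D \<and> rmem \<sigma> ''X'' = sol D"

lemma setup_frame_inputs:
  assumes "setup_frame \<sigma>"
  shows "nmem \<sigma> ''n'' 0 0 = n" "nmem \<sigma> ''m'' 0 0 = m" "i < m \<Longrightarrow> j < n \<Longrightarrow> nmem \<sigma> ''s'' i j = s i j"
    "rmem \<sigma> ''p'' 0 0 = p" "rmem \<sigma> ''C'' 0 0 = C" "i < m \<Longrightarrow> j < n \<Longrightarrow> rmem \<sigma> ''x'' i j = x i j"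
  using assms by (simp_all add: frame_nmem[OF assms] frame_rmem[OF assms])

lemma a_eq_exp:
  "j < n \<Longrightarrow> 0 < s i j \<Longrightarrow>
   a i j = f j (real (rspeed I C i j)) * exp (p * ln (real (rspeed I C i j) / real (s i j)))"
  using rspeed_pos[of j i] by (simp add: a_def powr_def)

lemma run_coef_com:
  assumes inv: "setup_inv D \<sigma>" and ij: "nmem \<sigma> ''i'' 0 0 = i" "nmem \<sigma> ''j'' 0 0 = j" "i < m" "j < n"
    and g: "nmem \<sigma> ''g'' j 0 = g j"
  shows "run f coef_com \<sigma> 8
    (\<lambda>\<sigma>'. frame {''r''} {''c'', ''X''} \<sigma> \<sigma>' \<and> setup_inv (insert (i, j) D) \<sigma>')"
proof -
  have F: "setup_frame \<sigma>" using inv by (simp add: setup_inv_def)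
  note inputs = setup_frame_inputs[OF F]
  \<comment> \<open>At speed 0 the program does not write the machine row; the cell already holds
    the right coefficient 0.\<close>
  have coef_0: "coef D (n + i) j = a i j" if "s i j = 0"
    using that by (simp add: coef_def a_def)
  show ?thesis
    unfolding coef_com_def
  proof (rule run_Seq_le[where M = 5 and N = 3 and Q = "\<lambda>\<sigma>'. frame {''r''} {''c''} \<sigma> \<sigma>' \<and>
       rmem \<sigma>' ''c'' = (coef D)(n + i := (coef D (n + i))(j := a i j))"], goal_cases)
    case 1
    show ?case
    proof (rule run_Cond_le, goal_cases)
      case 1
      then have s: "0 < s i j" using inputs ij by simp
      show ?case
      proof (rule run_Seq_NAssign_le, rule run_Seq_le[where M = 2 and N = 1 and Q = "\<lambda>\<sigma>'. frame {''r''} {} \<sigma> \<sigma>' \<and>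
           nmem \<sigma>' ''r'' 0 0 = rspeed I C i j"], goal_cases)
        case 1
        show ?case
          using inputs ij g by (intro run_Cond_le run_NAssign run_Skip) (auto simp: rspeed_def)
      next
        case (2 \<sigma>')
        then have eqs: "nmem \<sigma>' ''n'' = nmem \<sigma> ''n''" "nmem \<sigma>' ''i'' = nmem \<sigma> ''i''"
          "nmem \<sigma>' ''j'' = nmem \<sigma> ''j''" "nmem \<sigma>' ''s'' = nmem \<sigma> ''s''" "rmem \<sigma>' = rmem \<sigma>"
          by (auto simp: frame_def)
        have "frame {''r''} {''c''} \<sigma> (\<sigma>'\<lparr>rmem := rmem \<sigma>\<rparr>)" using 2 by (simp add: frame_def)
        then show ?case
          using 2 inputs ij s inv
          by (intro run_RAssign) (auto simp: eqs a_eq_exp setup_inv_def intro: frame_mono)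
      qed simp_all
    next
      case 2
      then have "s i j = 0" using inputs ij by simp
      from coef_0[OF this] show ?case using inv by (intro run_Skip) (auto simp: setup_inv_def fun_upd_idem)
    qed simp
  next
    case (2 \<sigma>')
    then have eqs: "nmem \<sigma>' ''n'' = nmem \<sigma> ''n''" "nmem \<sigma>' ''i'' = nmem \<sigma> ''i''"
      "nmem \<sigma>' ''j'' = nmem \<sigma> ''j''" "rmem \<sigma>' ''x'' = rmem \<sigma> ''x''" "rmem \<sigma>' ''X'' = rmem \<sigma> ''X''"
      and F': "frame {''r''} {''c'', ''X''} \<sigma> \<sigma>'" "setup_frame \<sigma>'"
      using F by (auto simp: frame_def)
    show ?case
      using 2 inputs ij inv F'
      by (intro run_Seq_RAssign_le run_RAssign) (auto simp: eqs setup_inv_def coef_insert sol_insert)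
  qed simp
qed

lemma run_setup_com:
  "run f setup_com \<sigma>\<^sub>0 (2 + n * (24 + 12 * input_size I + 10 * m)) (setup_inv ({..<m} \<times> {..<n}))"
proof -
  let ?J = "\<lambda>j \<sigma>. setup_inv ({..<m} \<times> {..<j}) \<sigma> \<and> nmem \<sigma> ''j'' 0 0 = j"
  let ?I = "\<lambda>j i \<sigma>. setup_inv ({..<m} \<times> {..<j} \<union> {..<i} \<times> {j}) \<sigma> \<and>
    nmem \<sigma> ''j'' 0 0 = j \<and> nmem \<sigma> ''i'' 0 0 = i \<and> nmem \<sigma> ''g'' j 0 = g j"
  have upd: "setup_inv D (\<sigma>\<lparr>nmem := upd2 (nmem \<sigma>) v k l w\<rparr>) \<longleftrightarrow> setup_inv D \<sigma>"
    if "v \<in> {''i'', ''j''}" for D \<sigma> v k l w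
    using that by (auto simp: setup_inv_def)
  have "run f setup_com \<sigma>\<^sub>0 (2 + n * ((12 * input_size I + 20 + (2 + m * (8 + 2))) + 2)) (?J n)"
    unfolding setup_com_def
  proof (rule run_For[where J = ?J], goal_cases)
    case 1
    have "coef {} = (\<lambda>u v. 0)" "sol {} = (\<lambda>u v. 0)" by (simp_all add: coef_def sol_def fun_eq_iff)
    then have "setup_inv {} \<sigma>\<^sub>0" by (simp add: setup_inv_def input_state_def)
    then show ?case by (simp add: upd)
  next
    case (2 k \<sigma>)
    then show ?case using setup_frame_inputs[of \<sigma>] by (simp add: setup_inv_def)
  next
    case (3 j \<sigma>)
    then have F: "setup_frame \<sigma>" by (simp add: setup_inv_def)
    show ?case
    proof (rule run_Seq, rule run_gamma_com[of _ j], goal_cases)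
      case (4 \<sigma>1)
      then have "setup_frame \<sigma>1" using F by (auto intro: frame_trans)
      then have inv1: "setup_inv ({..<m} \<times> {..<j}) \<sigma>1" and j1: "nmem \<sigma>1 ''j'' 0 0 = j"
        using 3 4 by (auto simp: setup_inv_def frame_def)
      have "run f (For ''i'' (NVar ''m'') coef_com) \<sigma>1 (2 + m * (8 + 2)) (?I j m)"
      proof (rule run_For[where J = "?I j"], goal_cases)
        case 1
        show ?case using inv1 j1 4 by (simp add: upd)
      next
        case (2 k \<sigma>2)
        then show ?case using setup_frame_inputs[of \<sigma>2] by (simp add: setup_inv_def)
      next
        case (3 i \<sigma>2)
        have D: "insert (i, j) ({..<m} \<times> {..<j} \<union> {..<i} \<times> {j}) = {..<m} \<times> {..<j} \<union> {..<Suc i} \<times> {j}"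
          by auto
        have "run f coef_com \<sigma>2 8 (\<lambda>\<sigma>'. frame {''r''} {''c'', ''X''} \<sigma>2 \<sigma>' \<and>
            setup_inv (insert (i, j) ({..<m} \<times> {..<j} \<union> {..<i} \<times> {j})) \<sigma>')"
          using 3 \<open>j < n\<close> by (intro run_coef_com) auto
        then show ?case
          by (rule run_mono) (use 3 D in \<open>auto simp: upd frame_def\<close>)
      qed
      moreover have "{..<m} \<times> {..<j} \<union> {..<m} \<times> {j} = {..<m} \<times> {..<Suc j}" by auto
      ultimately show ?case
        by (elim run_mono) (auto simp: upd)
    qed (use 3 setup_frame_inputs[OF F] in auto)
  qed
  then show ?thesis by (rule run_mono) (auto simp: algebra_simps)
qed

end


section \<open>Pointer walks and cycle cancelling\<close>

definition walk_com :: "nexp \<Rightarrow> com" where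
  "walk_com u =
   Seq (NSet ''L'' (NConst 0))
  (Seq (NSet ''path'' u)
       (While (NLess (NConst 0) (NAt ''par'' (NAt ''path'' (NVar ''L''))))
         (Seq (NArr ''path'' (NAdd (NVar ''L'') (NConst 1))
                 (NSub (NAt ''par'' (NAt ''path'' (NVar ''L''))) (NConst 1)))
              (NSet ''L'' (NAdd (NVar ''L'') (NConst 1))))))"

definition reroot_com :: com where
  "reroot_com =
   Seq (For ''t'' (NVar ''L'') (NArr ''par'' (NAt ''path'' (NAdd (NVar ''t'') (NConst 1)))
          (NAdd (NAt ''path'' (NVar ''t'')) (NConst 1))))
       (NArr ''par'' (NVar ''path'') (NConst 0))"

abbreviation "parent \<sigma> \<equiv> (\<lambda>v. nmem \<sigma> ''par'' v 0)"
abbreviation "path \<sigma> \<equiv> (\<lambda>t. nmem \<sigma> ''path'' t 0)"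
abbreviation "len \<sigma> \<equiv> nmem \<sigma> ''L'' 0 0"

lemma run_walk_com:
  assumes acyc: "acyclic_ptr (parent \<sigma>)" and bound: "\<And>v u. parent \<sigma> v = Suc u \<Longrightarrow> u < N"
    and u: "nval (\<sigma>\<lparr>nmem := upd2 (nmem \<sigma>) ''L'' 0 0 0\<rparr>) u = v" "v < N"
  shows "run orc (walk_com u) \<sigma> (3 + 3 * N)
    (\<lambda>\<sigma>'. frame {''L'', ''path''} {} \<sigma> \<sigma>' \<and> path \<sigma>' 0 = v \<and> chain (parent \<sigma>) (path \<sigma>') (len \<sigma>') \<and>
       parent \<sigma> (path \<sigma>' (len \<sigma>')) = 0 \<and> (\<forall>t\<le>len \<sigma>'. path \<sigma>' t < N) \<and> len \<sigma>' < N)"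
proof -
  let ?J = "\<lambda>\<sigma>'. frame {''L'', ''path''} {} \<sigma> \<sigma>' \<and> path \<sigma>' 0 = v \<and> chain (parent \<sigma>) (path \<sigma>') (len \<sigma>') \<and>
    (\<forall>t\<le>len \<sigma>'. path \<sigma>' t < N)"
  have less: "len \<sigma>' < N" if "?J \<sigma>'" for \<sigma>'
    using chain_length_less[OF acyc] that by blast
  show ?thesis
    unfolding walk_com_def
  proof (intro run_Seq_NAssign_le, rule run_mono,
      rule run_While[where J = ?J and K = N and V = "\<lambda>\<sigma>'. N - len \<sigma>'" and B = 2], goal_cases)
    case 1
    show ?case using u by (simp add: chain_def)
  next
    case (2 \<sigma>')
    define l where "l = len \<sigma>'"
    have par: "nmem \<sigma>' ''par'' = nmem \<sigma> ''par''" using 2 by (simp add: frame_def)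
    then obtain w where w: "parent \<sigma> (path \<sigma>' l) = Suc w"
      using 2 by (cases "parent \<sigma> (path \<sigma>' l)") (auto simp: l_def)
    have "w < N" using bound w .
    have J: "?J \<sigma>'" using 2 by blast
    let ?\<sigma> = "\<sigma>'\<lparr>nmem := upd2 (upd2 (nmem \<sigma>') ''path'' (Suc l) 0 w) ''L'' 0 0 (Suc l)\<rparr>"
    have "chain (parent \<sigma>) (path ?\<sigma>) (Suc l)"
      using J w by (auto simp: chain_def l_def less_Suc_eq)
    moreover have "\<forall>t\<le>Suc l. path ?\<sigma> t < N"
      using J \<open>w < N\<close> by (auto simp: l_def)
    ultimately have "?J ?\<sigma> \<and> N - len ?\<sigma> < N - len \<sigma>'"
      using J less[OF J] by (simp add: l_def)
    then show ?case
      by (intro run_Seq_NAssign_le run_NAssign) (simp_all add: par w flip: l_def)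
  next
    case (4 \<sigma>')
    then have "parent \<sigma>' = parent \<sigma>" by (simp add: frame_def)
    then show ?case using 4 less by (auto simp: fun_eq_iff)
  qed simp_all
qed

lemma run_reroot_com:
  assumes acyc: "acyclic_ptr (parent \<sigma>)" and chain: "chain (parent \<sigma>) (path \<sigma>) (len \<sigma>)"
    and root: "parent \<sigma> (path \<sigma> (len \<sigma>)) = 0"
  shows "run orc reroot_com \<sigma> (3 + 3 * len \<sigma>)
    (\<lambda>\<sigma>'. frame {''t'', ''par''} {} \<sigma> \<sigma>' \<and> rerooting (parent \<sigma>) (parent \<sigma>') (path \<sigma>) (len \<sigma>))"
proof -
  define p L where "p = path \<sigma>" and "L = len \<sigma>"
  have inj: "inj_on p {..L}" using chain_inj_on[OF acyc chain] by (simp add: p_def L_def)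
  let ?J = "\<lambda>k \<sigma>'. frame {''t'', ''par''} {} \<sigma> \<sigma>' \<and> nmem \<sigma>' ''t'' 0 0 = k \<and>
    (\<forall>t<k. parent \<sigma>' (p (Suc t)) = Suc (p t)) \<and> (\<forall>v. v \<notin> p ` {..L} \<longrightarrow> parent \<sigma>' v = parent \<sigma> v)"
  show ?thesis
    unfolding reroot_com_def
  proof (rule run_Seq_le[where N = 1], rule run_For[where J = ?J and K = L and B = 1], goal_cases)
    case (3 k \<sigma>')
    then have path: "nmem \<sigma>' ''path'' = nmem \<sigma> ''path''" by (simp add: frame_def)
    \<comment> \<open>Path vertices are distinct, so a reversed pointer is not overwritten in a
      later round.\<close>
    have "p (Suc t) \<noteq> p (Suc k)" if "t < k" for t
      using inj_onD[OF inj, of "Suc t" "Suc k"] that 3 by auto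
    then show ?case
      using 3 by (intro run_NAssign) (auto simp: path p_def less_Suc_eq)
  next
    case (4 \<sigma>')
    then have path: "nmem \<sigma>' ''path'' = nmem \<sigma> ''path''" by (simp add: frame_def)
    let ?\<sigma> = "\<sigma>'\<lparr>nmem := upd2 (nmem \<sigma>') ''par'' (p 0) 0 0\<rparr>"
    have ne: "p (Suc t) \<noteq> p 0" if "t < L" for t
      using inj_onD[OF inj, of "Suc t" 0] that by auto
    have "rerooting (parent \<sigma>) (parent ?\<sigma>) p L"
      using acyc chain root ne 4 by unfold_locales (auto simp: p_def L_def)
    then show ?case
      using 4 by (intro run_NAssign[where B = 1]) (simp_all add: path p_def L_def)
  qed (auto simp: p_def L_def frame_def)
qed

abbreviation path_at :: "nexp \<Rightarrow> nexp" where "path_at e \<equiv> NAt ''path'' e"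
abbreviation succ :: "nexp \<Rightarrow> nexp" where "succ e \<equiv> NAdd e (NConst 1)"
abbreviation edge_val :: "string \<Rightarrow> nexp \<Rightarrow> rexp" where
  "edge_val A e \<equiv> RCell A (path_at e) (path_at (succ e))"

text \<open>For a cycle through \<open>path 0, \<dots>, path L\<close>, the edge \<open>t\<close> joins \<open>path t\<close> and \<open>path (t + 1)\<close>, where
  \<open>path (L + 1) = path 0\<close>; \<open>y t\<close> is the direction of the shift on it and \<open>b\<close> the edge that is emptied.\<close>

definition direction_com :: com where
  "direction_com =
   Seq (RArr ''y'' (NConst 0) (ROf (NConst 1)))
  (Seq (For ''t'' (NVar ''L'') (RArr ''y'' (succ (NVar ''t''))
          (RDiv (RMul (RSub (ROf (NConst 0)) (RAt ''y'' (NVar ''t'')))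
                   (RCell ''c'' (path_at (succ (NVar ''t''))) (path_at (NVar ''t''))))
             (edge_val ''c'' (succ (NVar ''t''))))))
  (Seq (NSet ''b'' (NConst 1))
       (Cond (RLess (ROf (NConst 0))
                (RAdd (RMul (edge_val ''c'' (NConst 0)) (RAt ''y'' (NConst 0)))
                      (RMul (RCell ''c'' (path_at (NConst 0)) (path_at (NVar ''L''))) (RAt ''y'' (NVar ''L'')))))
          (Seq (NSet ''b'' (NConst 0))
               (For ''t'' (succ (NVar ''L''))
                  (RArr ''y'' (NVar ''t'') (RSub (ROf (NConst 0)) (RAt ''y'' (NVar ''t''))))))
          Skip)))"

abbreviation ratio :: "nexp \<Rightarrow> rexp" where
  "ratio e \<equiv> RDiv (edge_val ''X'' e) (RSub (ROf (NConst 0)) (RAt ''y'' e))"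

definition ratio_com :: com where
  "ratio_com =
   For ''t'' (succ (NVar ''L''))
     (Cond (BAnd (RLess (RAt ''y'' (NVar ''t'')) (ROf (NConst 0))) (RLess (ratio (NVar ''t'')) (ratio (NVar ''b''))))
        (NSet ''b'' (NVar ''t'')) Skip)"

definition push_com :: com where
  "push_com =
   Seq (RSet ''th'' (ratio (NVar ''b'')))
       (For ''t'' (succ (NVar ''L''))
         (Seq (RAssign ''X'' (path_at (NVar ''t'')) (path_at (succ (NVar ''t'')))
                 (RAdd (edge_val ''X'' (NVar ''t'')) (RMul (RVar ''th'') (RAt ''y'' (NVar ''t'')))))
              (RAssign ''X'' (path_at (succ (NVar ''t''))) (path_at (NVar ''t''))
                 (RAdd (RCell ''X'' (path_at (succ (NVar ''t''))) (path_at (NVar ''t'')))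
                    (RMul (RVar ''th'') (RAt ''y'' (NVar ''t'')))))))"

definition relink_com :: com where
  "relink_com =
   Cond (NLess (NVar ''b'') (NVar ''L''))
     (Seq (NArr ''par'' (path_at (NVar ''b'')) (NConst 0))
          (NArr ''par'' (path_at (NVar ''L'')) (succ (path_at (NConst 0)))))
     Skip"

definition cancel_com :: com where
  "cancel_com =
   Seq (NArr ''path'' (succ (NVar ''L'')) (path_at (NConst 0)))
  (Seq direction_com (Seq ratio_com (Seq push_com relink_com)))"

locale cancel_walk = closed_walk +
  fixes c :: "nat \<Rightarrow> nat \<Rightarrow> real"
  assumes pos: "\<And>k. k \<le> L \<Longrightarrow> 0 < c (p k) (p (Suc k)) \<and> 0 < c (p (Suc k)) (p k)"
begin

definition direction :: "(nat \<Rightarrow> real) \<Rightarrow> bool" where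
  "direction y \<longleftrightarrow>
     (\<forall>k<L. c (p (Suc k)) (p (Suc (Suc k))) * y (Suc k) + c (p (Suc k)) (p k) * y k = 0) \<and>
     c (p 0) (p 1) * y 0 + c (p 0) (p L) * y L \<le> 0"

text \<open>From \<open>y 0 = 1\<close> each balance determines the next entry, with alternating
  signs because the coefficients are positive. If the balance at \<open>p 0\<close> comes out
  positive, the vector is negated, which keeps the other balances at 0. The initial \<open>b\<close>
  is an entry known to be negative: 1 without the negation, 0 after it.\<close>

lemma run_direction_com:
  assumes path: "path \<sigma> = p" and len: "len \<sigma> = L" and c: "rmem \<sigma> ''c'' = c"
  shows "run orc direction_com \<sigma> (12 + 6 * L)
    (\<lambda>\<sigma>'. frame {''t'', ''b''} {''y''} \<sigma> \<sigma>' \<and> direction (\<lambda>k. rmem \<sigma>' ''y'' k 0) \<and>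
       nmem \<sigma>' ''b'' 0 0 \<le> L \<and> rmem \<sigma>' ''y'' (nmem \<sigma>' ''b'' 0 0) 0 < 0)"
proof -
  let ?y = "\<lambda>\<sigma> k. rmem \<sigma> ''y'' k 0"
  let ?J = "\<lambda>k \<sigma>'. frame {''t''} {''y''} \<sigma> \<sigma>' \<and> nmem \<sigma>' ''t'' 0 0 = k \<and> ?y \<sigma>' 0 = 1 \<and>
    (\<forall>t<k. ?y \<sigma>' (Suc t) = (0 - ?y \<sigma>' t) * c (p (Suc t)) (p t) / c (p (Suc t)) (p (Suc (Suc t))))"
  have eqs: "path \<sigma>' = p" "len \<sigma>' = L" "rmem \<sigma>' ''c'' = c"
    if "frame {''t'', ''b''} {''y''} \<sigma> \<sigma>'" for \<sigma>'
    using that assms by (auto simp: frame_def)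
  note path_eq = fun_cong[OF eqs(1)]
  show ?thesis
    unfolding direction_com_def
  proof (rule run_Seq_RAssign_le, rule run_Seq_le[where M = "2 + L * (1 + 2)" and N = "9 + 3 * L"],
      rule run_For[where J = ?J], goal_cases)
    case (2 k \<sigma>')
    then show ?case using eqs[of \<sigma>'] frame_mono[of "{''t''}" "{''y''}" \<sigma> \<sigma>' "{''t'', ''b''}" "{''y''}"] by auto
  next
    case (3 k \<sigma>')
    then have "frame {''t'', ''b''} {''y''} \<sigma> \<sigma>'" by (auto intro: frame_mono)
    with 3 show ?case
      using eqs[of \<sigma>'] path_eq[of \<sigma>'] by (intro run_RAssign) (auto simp: less_Suc_eq)
  next
    case (4 \<sigma>')
    then have F: "frame {''t'', ''b''} {''y''} \<sigma> \<sigma>'" by (auto intro: frame_mono)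
    define y where "y = ?y \<sigma>'"
    have bal: "c (p (Suc k)) (p (Suc (Suc k))) * y (Suc k) + c (p (Suc k)) (p k) * y k = 0" if "k < L" for k
      using 4 that pos[of "Suc k"] by (simp add: y_def)
    have y: "y 0 = 1" "y 1 < 0"
      using 4 pos[of 0] pos[of 1] long by (auto simp: y_def divide_neg_pos)
    show ?case
    proof (rule run_Seq_NAssign_le, rule run_Cond_le, goal_cases)
      case 1
      let ?K = "\<lambda>k \<sigma>1. frame {''t'', ''b''} {''y''} \<sigma> \<sigma>1 \<and> nmem \<sigma>1 ''t'' 0 0 = k \<and> nmem \<sigma>1 ''b'' 0 0 = 0 \<and>
        (\<forall>t. ?y \<sigma>1 t = (if t < k then - y t else y t))"
      have D: "0 < c (p 0) (p 1) * y 0 + c (p 0) (p L) * y L"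
        using 1 F eqs[OF F] path_eq[OF F] by (simp add: y_def)
      show ?case
      proof (rule run_Seq_NAssign_le, rule run_mono, rule run_For[where J = ?K and K = "Suc L" and B = 1], goal_cases)
        case 1
        show ?case using F by (simp add: y_def)
      next
        case (2 k \<sigma>1)
        then show ?case using eqs[of \<sigma>1] by auto
      next
        case (3 k \<sigma>1)
        then show ?case by (intro run_RAssign) auto
      next
        case (4 \<sigma>1)
        then have neg: "?y \<sigma>1 t = - y t" if "t \<le> L" for t using that by auto
        have "c (p (Suc k)) (p (Suc (Suc k))) * - y (Suc k) + c (p (Suc k)) (p k) * - y k = 0" if "k < L" for k
          using bal[OF that] by simp
        moreover have "c (p 0) (p 1) * - y 0 + c (p 0) (p L) * - y L \<le> 0" using D by simp
        ultimately have "direction (?y \<sigma>1)" by (simp add: direction_def neg)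
        then show ?case using 4 neg[of 0] y(1) by simp
      qed auto
    next
      case 2
      have D: "\<not> 0 < c (p 0) (p 1) * y 0 + c (p 0) (p L) * y L"
        using 2 F eqs[OF F] path_eq[OF F] by (simp add: y_def)
      show ?case using F bal D y long by (intro run_Skip) (auto simp: direction_def y_def)
    qed simp_all
  qed simp_all
qed

lemma run_ratio_com:
  assumes path: "path \<sigma> = p" and len: "len \<sigma> = L" and b: "nmem \<sigma> ''b'' 0 0 \<le> L"
    and y: "rmem \<sigma> ''y'' (nmem \<sigma> ''b'' 0 0) 0 < 0"
  shows "run orc ratio_com \<sigma> (6 + 4 * L)
    (\<lambda>\<sigma>'. frame {''t'', ''b''} {} \<sigma> \<sigma>' \<and> (\<exists>b. nmem \<sigma>' ''b'' 0 0 = b \<and> b \<le> L \<and> rmem \<sigma> ''y'' b 0 < 0 \<and>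
       (\<forall>k\<le>L. rmem \<sigma> ''y'' k 0 < 0 \<longrightarrow>
          rmem \<sigma> ''X'' (p b) (p (Suc b)) / (- rmem \<sigma> ''y'' b 0) \<le> rmem \<sigma> ''X'' (p k) (p (Suc k)) / (- rmem \<sigma> ''y'' k 0))))"
proof -
  define y where "y k = rmem \<sigma> ''y'' k 0" for k
  define R where "R k = rmem \<sigma> ''X'' (p k) (p (Suc k)) / (- y k)" for k
  let ?J = "\<lambda>k \<sigma>'. frame {''t'', ''b''} {} \<sigma> \<sigma>' \<and> nmem \<sigma>' ''t'' 0 0 = k \<and> nmem \<sigma>' ''b'' 0 0 \<le> L \<and>
    y (nmem \<sigma>' ''b'' 0 0) < 0 \<and> (\<forall>k'<k. y k' < 0 \<longrightarrow> R (nmem \<sigma>' ''b'' 0 0) \<le> R k')"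
  show ?thesis
    unfolding ratio_com_def
  proof (rule run_mono, rule run_For[where J = ?J and K = "Suc L" and B = 2], goal_cases)
    case 1
    show ?case using b y by (simp add: y_def)
  next
    case (2 k \<sigma>')
    then show ?case using len by (auto simp: frame_def)
  next
    case (3 k \<sigma>')
    then have eqs: "path \<sigma>' = p" "rmem \<sigma>' ''y'' = rmem \<sigma> ''y''" "rmem \<sigma>' ''X'' = rmem \<sigma> ''X''" 
      using path by (auto simp: frame_def)
    note path_eq = fun_cong[OF eqs(1)]
    show ?case
    proof (rule run_Cond_le, goal_cases)
      case 1
      then have *: "y k < 0" "R k < R (nmem \<sigma>' ''b'' 0 0)"
        using 3 by (simp_all add: eqs path_eq y_def R_def)
      have "\<forall>k'<Suc k. y k' < 0 \<longrightarrow> R k \<le> R k'"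
        using 3 * by (auto simp: less_Suc_eq intro: order_trans less_imp_le)
      then show ?case using 3 * by (intro run_NAssign) auto
    next
      case 2
      then have "\<not> (y k < 0 \<and> R k < R (nmem \<sigma>' ''b'' 0 0))"
        using 3 by (simp add: eqs path_eq y_def R_def)
      then show ?case using 3 by (intro run_Skip) (auto simp: less_Suc_eq)
    qed simp
  next
    case (4 \<sigma>')
    then show ?case by (auto simp: y_def R_def less_Suc_eq_le)
  qed simp
qed

lemma run_push_com:
  assumes path: "path \<sigma> = p" and len: "len \<sigma> = L" and b: "nmem \<sigma> ''b'' 0 0 = b"
  shows "run orc push_com \<sigma> (7 + 4 * L)
    (\<lambda>\<sigma>'. frame {''t''} {''th'', ''X''} \<sigma> \<sigma>' \<and>
       (\<forall>u v. rmem \<sigma>' ''X'' u v = rmem \<sigma> ''X'' u v +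
          rmem \<sigma> ''X'' (p b) (p (Suc b)) / (- rmem \<sigma> ''y'' b 0) * cycle_vec p (\<lambda>k. rmem \<sigma> ''y'' k 0) (Suc L) u v))"
proof -
  define th where "th = rmem \<sigma> ''X'' (p b) (p (Suc b)) / (- rmem \<sigma> ''y'' b 0)"
  let ?J = "\<lambda>k \<sigma>'. frame {''t''} {''th'', ''X''} \<sigma> \<sigma>' \<and> nmem \<sigma>' ''t'' 0 0 = k \<and> rmem \<sigma>' ''th'' 0 0 = th \<and>
    (\<forall>u v. rmem \<sigma>' ''X'' u v = rmem \<sigma> ''X'' u v + th * cycle_vec p (\<lambda>k. rmem \<sigma> ''y'' k 0) k u v)"
  note path_eq = fun_cong[OF path]
  show ?thesis
    unfolding push_com_def
  proof (rule run_Seq_RAssign_le, rule run_mono, rule run_For[where J = ?J and K = "Suc L" and B = 2], goal_cases)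
    case 1
    show ?case by (simp add: b path_eq th_def cycle_vec_def)
  next
    case (2 k \<sigma>')
    then show ?case using len by (auto simp: frame_def)
  next
    case (3 k \<sigma>')
    then have eqs: "path \<sigma>' = p" "rmem \<sigma>' ''y'' = rmem \<sigma> ''y''" using path by (auto simp: frame_def)
    note path_eq = fun_cong[OF eqs(1)]
    \<comment> \<open>Hence the two writes of a round hit different cells and neither receives the
      shift twice.\<close>
    have "p k \<noteq> p (Suc k)" using 3 eq_Suc_iff[of k k] long by (auto split: if_splits)
    then show ?case
      using 3 by (intro run_Seq_RAssign_le run_RAssign) (auto simp: eqs path_eq cycle_vec_Suc algebra_simps)
  next
    case (4 \<sigma>')
    then show ?case by (simp add: th_def)
  qed simp_all
qed

end

lemma run_cancel_com:
  assumes F: "forest_inv N n c X0 W (rmem \<sigma> ''X'') (parent \<sigma>)" and c: "rmem \<sigma> ''c'' = c"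
    and chain: "chain (parent \<sigma>) (path \<sigma>) (len \<sigma>)" and root: "parent \<sigma> (path \<sigma> (len \<sigma>)) = 0"
    and len: "len \<sigma> = L" "2 \<le> L" and bound: "\<forall>t\<le>L. path \<sigma> t < N" and n: "n \<le> path \<sigma> 0"
    and pos: "0 < c (path \<sigma> 0) (path \<sigma> L)" "0 < c (path \<sigma> L) (path \<sigma> 0)"
  shows "run orc cancel_com \<sigma> (30 + 14 * L)
    (\<lambda>\<sigma>'. frame {''path'', ''t'', ''b'', ''par''} {''y'', ''th'', ''X''} \<sigma> \<sigma>' \<and>
       forest_inv N n c X0 (insert (path \<sigma> 0, path \<sigma> L) W) (rmem \<sigma>' ''X'') (parent \<sigma>'))"
proof -
  \<comment> \<open>\<open>cancel_com\<close> stores this closing copy of the start vertex before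
    anything else.\<close>
  define p where "p = (path \<sigma>)(Suc L := path \<sigma> 0)"
  have acyc: "acyclic_ptr (parent \<sigma>)" and valid: "\<And>v u. parent \<sigma> v = Suc u \<Longrightarrow> 0 < c v u \<and> 0 < c u v"
    using F unfolding forest_inv_def by blast+
  have p_le: "p t = path \<sigma> t" if "t \<le> L" for t using that by (simp add: p_def)
  have p_Suc: "p (Suc L) = p 0" by (simp add: p_def)
  have chain_p: "chain (parent \<sigma>) p L" using chain len by (simp add: chain_def p_le)
  have root_p: "parent \<sigma> (p L) = 0" using root len by (simp add: p_le)
  interpret cancel_walk p L N c
  proof
    show "inj_on p {..L}" using acyc chain_p by (rule chain_inj_on)
    show "0 < c (p k) (p (Suc k)) \<and> 0 < c (p (Suc k)) (p k)" if "k \<le> L" for k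
    proof (cases "k = L")
      case True
      then show ?thesis using pos by (simp add: p_def)
    next
      case False
      then show ?thesis using chain_p that valid by (simp add: chain_def)
    qed
  qed (use len bound p_le p_Suc in auto)
  let ?\<sigma> = "\<sigma>\<lparr>nmem := upd2 (nmem \<sigma>) ''path'' (Suc L) 0 (path \<sigma> 0)\<rparr>"
  have path1: "path ?\<sigma> = p" by (auto simp: p_def)
  have "run orc (Seq direction_com (Seq ratio_com (Seq push_com relink_com))) ?\<sigma>
     ((12 + 6 * L) + ((6 + 4 * L) + ((7 + 4 * L) + 3)))
    (\<lambda>\<sigma>'. frame {''path'', ''t'', ''b'', ''par''} {''y'', ''th'', ''X''} \<sigma> \<sigma>' \<and>
       forest_inv N n c X0 (insert (p 0, p L) W) (rmem \<sigma>' ''X'') (parent \<sigma>'))"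
  proof (rule run_Seq, rule run_direction_com, goal_cases)
    case (4 \<sigma>1)
    define y where "y k = rmem \<sigma>1 ''y'' k 0" for k
    have dir: "direction y" using 4 by (simp add: y_def[abs_def])
    have s1: "path \<sigma>1 = p" "len \<sigma>1 = L" "rmem \<sigma>1 ''X'' = rmem \<sigma> ''X''" "nmem \<sigma>1 ''par'' = nmem \<sigma> ''par''"
      using 4 path1 len by (auto simp: frame_def)
    show ?case
    proof (rule run_Seq, rule run_ratio_com, goal_cases)
      case (5 \<sigma>2)
      then obtain b where b: "nmem \<sigma>2 ''b'' 0 0 = b" "b \<le> L" "y b < 0"
        "\<And>k. k \<le> L \<Longrightarrow> y k < 0 \<Longrightarrow>
           rmem \<sigma> ''X'' (p b) (p (Suc b)) / (- y b) \<le> rmem \<sigma> ''X'' (p k) (p (Suc k)) / (- y k)"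
        by (auto simp: y_def s1)
      have s2: "path \<sigma>2 = p" "len \<sigma>2 = L" "rmem \<sigma>2 ''X'' = rmem \<sigma> ''X''"
        "nmem \<sigma>2 ''par'' = nmem \<sigma> ''par''" "rmem \<sigma>2 ''y'' = rmem \<sigma>1 ''y''"
        using 5 s1 by (auto simp: frame_def)
      show ?case
      proof (rule run_Seq, rule run_push_com[OF s2(1,2) b(1)], goal_cases)
        case (1 \<sigma>3)
        have s3: "path \<sigma>3 = p" "len \<sigma>3 = L" "nmem \<sigma>3 ''par'' = nmem \<sigma> ''par''" "nmem \<sigma>3 ''b'' 0 0 = b"
          using 1 s2 b by (auto simp: frame_def)
        note path_eq = fun_cong[OF s3(1)]
        have "frame {''path'', ''t'', ''b'', ''par''} {''y'', ''th'', ''X''} \<sigma> ?\<sigma>" by simp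
        then have "frame {''path'', ''t'', ''b'', ''par''} {''y'', ''th'', ''X''} \<sigma> \<sigma>1"
          by (rule frame_trans[OF _ conjunct1[OF 4]]) auto
        then have "frame {''path'', ''t'', ''b'', ''par''} {''y'', ''th'', ''X''} \<sigma> \<sigma>2"
          by (rule frame_trans[OF _ conjunct1[OF 5]]) auto
        then have F3: "frame {''path'', ''t'', ''b'', ''par''} {''y'', ''th'', ''X''} \<sigma> \<sigma>3"
          by (rule frame_trans[OF _ conjunct1[OF 1]]) auto
        have X': "rmem \<sigma>3 ''X'' u v = rmem \<sigma> ''X'' u v +
            rmem \<sigma> ''X'' (p b) (p (Suc b)) / (- y b) * cycle_vec p y (Suc L) u v" for u v
          using conjunct2[OF 1] unfolding s2 y_def by blast
        define par' where "par' = (if b = L then parent \<sigma> else ((parent \<sigma>)(p b := 0))(p L := Suc (p 0)))"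
        have inv: "forest_inv N n c X0 (insert (p 0, p L) W) (rmem \<sigma>3 ''X'') par'"
          by (rule forest_inv_cancel[OF F closed_walk_axioms _ chain_p root_p pos _ _ b(2,3,4) refl X' par'_def])
            (use n dir in \<open>auto simp: p_le direction_def\<close>)
        show ?case
          unfolding relink_com_def
        proof (rule run_Cond_le, goal_cases)
          case 1
          then have "b < L" using s3 by simp
          then have "par' = (\<lambda>v. if v = p L then Suc (p 0) else if v = p b then 0 else parent \<sigma> v)"
            by (auto simp: par'_def)
          with inv F3 show ?case
            by (intro run_Seq_NAssign_le run_NAssign) (simp_all add: s3 path_eq fun_upd_def if_distrib[of "\<lambda>h. h 0"] cong: if_cong)
        next
          case 2
          then have "b = L" using s3 b(2) by simp
          with inv F3 show ?case by (intro run_Skip) (simp_all add: par'_def s3)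
        qed simp
      qed
    qed (use 4 s1 in auto)
  qed (use path1 len c in auto)
  then have "run orc (Seq direction_com (Seq ratio_com (Seq push_com relink_com))) ?\<sigma> (29 + 14 * L)
    (\<lambda>\<sigma>'. frame {''path'', ''t'', ''b'', ''par''} {''y'', ''th'', ''X''} \<sigma> \<sigma>' \<and>
       forest_inv N n c X0 (insert (p 0, p L) W) (rmem \<sigma>' ''X'') (parent \<sigma>'))"
    by (rule run_mono) auto
  then show ?thesis
    unfolding cancel_com_def by (intro run_Seq_NAssign_le) (simp_all add: len p_le)
qed


section \<open>Inserting the edges\<close>

text \<open>Rerooting at the job merges two tasks: the walk from the machine ends in
  \<open>j\<close> exactly if both lie in the same tree, and then it is the complete tree path
  between them. Otherwise \<open>j\<close> is a root and can be hung below the machine. Equality of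
  naturals is tested by two negated comparisons.\<close>

definition insert_com :: com where
  "insert_com =
   Cond (RLess (ROf (NConst 0)) (RCell ''c'' machine_vertex (NVar ''j'')))
     (Seq (walk_com (NVar ''j''))
     (Seq reroot_com
     (Seq (walk_com machine_vertex)
          (Cond (BAnd (BNot (NLess (path_at (NVar ''L'')) (NVar ''j''))) (BNot (NLess (NVar ''j'') (path_at (NVar ''L'')))))
             (Cond (NLess (NConst 1) (NVar ''L'')) cancel_com Skip)
             (NArr ''par'' (NVar ''j'') (succ machine_vertex))))))
     Skip"

definition forest_com :: com where
  "forest_com = For ''j'' (NVar ''n'') (For ''i'' (NVar ''m'') insert_com)"

lemma sum_lessThan_add: "(\<Sum>u<(a::nat) + b. h u) = (\<Sum>u<a. h u) + (\<Sum>u<b. h (a + u) :: 'a :: comm_monoid_add)"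
  by (induction b) (simp_all add: ac_simps)

context lp_solution
begin

abbreviation "cf \<equiv> coef ({..<m} \<times> {..<n})"
abbreviation "x\<^sub>0 \<equiv> sol ({..<m} \<times> {..<n})"

definition edges :: "(nat \<times> nat) set \<Rightarrow> (nat \<times> nat) set" where
  "edges D = {(n + i, j) |i j. (i, j) \<in> D \<and> 0 < a i j}"

abbreviation "forest W \<equiv> forest_inv (n + m) n cf x\<^sub>0 W"

abbreviation "forest_frame \<equiv> frame {''i'', ''j'', ''k'', ''pw'', ''q'', ''g'', ''r'', ''L'', ''path'', ''t'', ''b'', ''par''}
  {''c'', ''X'', ''y'', ''th''} \<sigma>\<^sub>0"

definition forest_state :: "(nat \<times> nat) set \<Rightarrow> state \<Rightarrow> bool" where
  "forest_state D \<sigma> \<longleftrightarrow> forest_frame \<sigma> \<and> rmem \<sigma> ''c'' = cf \<and>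
     forest (edges D) (rmem \<sigma> ''X'') (parent \<sigma>)"

lemma cf_machine: "i < m \<Longrightarrow> j < n \<Longrightarrow> cf (n + i) j = a i j"
  and cf_job: "i < m \<Longrightarrow> j < n \<Longrightarrow> cf j (n + i) = 1"
  by (simp_all add: coef_def)

lemma forest_frame_inputs:
  assumes "forest_frame \<sigma>"
  shows "nmem \<sigma> ''n'' 0 0 = n" "nmem \<sigma> ''m'' 0 0 = m" "i < m \<Longrightarrow> j < n \<Longrightarrow> nmem \<sigma> ''s'' i j = s i j"
    "rmem \<sigma> ''p'' 0 0 = p" "rmem \<sigma> ''C'' 0 0 = C"
  using assms by (simp_all add: frame_nmem[OF assms] frame_rmem[OF assms])

lemma edges_insert: "edges (insert (i, j) D) = (if 0 < a i j then insert (n + i, j) (edges D) else edges D)"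
  by (auto simp: edges_def)

lemma run_insert_com:
  assumes st: "forest_state D \<sigma>" and ij: "nmem \<sigma> ''i'' 0 0 = i" "nmem \<sigma> ''j'' 0 0 = j" "i < m" "j < n"
  shows "run f insert_com \<sigma> (50 + 23 * (n + m))
    (\<lambda>\<sigma>'. frame {''L'', ''path'', ''t'', ''b'', ''par''} {''y'', ''th'', ''X''} \<sigma> \<sigma>' \<and> forest_state (insert (i, j) D) \<sigma>')"
proof -
  define N where "N = n + m"
  define Fr where "Fr = frame {''L'', ''path'', ''t'', ''b'', ''par''} {''y'', ''th'', ''X''} \<sigma>"
  have F0: "forest_frame \<sigma>" and c: "rmem \<sigma> ''c'' = cf"
    and inv: "forest (edges D) (rmem \<sigma> ''X'') (parent \<sigma>)"
    using st by (auto simp: forest_state_def)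
  note inputs = forest_frame_inputs[OF F0]
  have finish: "Fr \<sigma>' \<and> forest_state (insert (i, j) D) \<sigma>'"
    if "Fr \<sigma>'" "0 < a i j" "forest (insert (n + i, j) (edges D)) (rmem \<sigma>' ''X'') (parent \<sigma>')" for \<sigma>'
  proof -
    have "forest_frame \<sigma>'" using F0 that(1) unfolding Fr_def by (rule frame_trans) auto
    moreover have "rmem \<sigma>' ''c'' = cf" using that(1) c by (simp add: Fr_def frame_def)
    ultimately show ?thesis using that by (simp add: forest_state_def edges_insert)
  qed
  have eqs: "nmem \<sigma>' ''i'' 0 0 = i" "nmem \<sigma>' ''j'' 0 0 = j" "nmem \<sigma>' ''n'' 0 0 = n" "rmem \<sigma>' ''c'' = cf"
    if "Fr \<sigma>'" for \<sigma>'
    using that ij inputs c by (auto simp: Fr_def frame_def)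
  have validity: "acyclic_ptr par" "\<And>v u. par v = Suc u \<Longrightarrow> u < N"
    if "forest W X par" for W X par
    using that unfolding forest_inv_def N_def by blast+
  show ?thesis
    unfolding insert_com_def Fr_def[symmetric]
  proof (rule run_Cond_le, goal_cases)
    case 1
    then have a: "0 < a i j" using ij inputs c by (simp add: cf_machine)
    have "run f (Seq (walk_com (NVar ''j''))
     (Seq reroot_com
     (Seq (walk_com machine_vertex)
          (Cond (BAnd (BNot (NLess (path_at (NVar ''L'')) (NVar ''j''))) (BNot (NLess (NVar ''j'') (path_at (NVar ''L'')))))
             (Cond (NLess (NConst 1) (NVar ''L'')) cancel_com Skip)
             (NArr ''par'' (NVar ''j'') (succ machine_vertex)))))) \<sigma>
       ((3 + 3 * N) + ((3 + 3 * N) + ((3 + 3 * N) + (32 + 14 * N))))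
       (\<lambda>\<sigma>'. Fr \<sigma>' \<and> forest_state (insert (i, j) D) \<sigma>')"
    proof (rule run_Seq, rule run_walk_com[where v = j and N = N], goal_cases)
      case (5 \<sigma>1)
      then have par1: "nmem \<sigma>1 ''par'' = nmem \<sigma> ''par''" and X1: "rmem \<sigma>1 ''X'' = rmem \<sigma> ''X''" by (auto simp: frame_def)
      have F1: "Fr \<sigma>1" using 5 unfolding Fr_def by (auto intro: frame_mono)
      have "run f reroot_com \<sigma>1 (3 + 3 * N)
        (\<lambda>\<sigma>'. frame {''t'', ''par''} {} \<sigma>1 \<sigma>' \<and> rerooting (parent \<sigma>1) (parent \<sigma>') (path \<sigma>1) (len \<sigma>1))"
        by (rule run_mono[OF run_reroot_com]) (use 5 par1 validity[OF inv] in auto)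
      then show ?case
      proof (rule run_Seq, goal_cases)
        case (1 \<sigma>2)
        then have X2: "rmem \<sigma>2 ''X'' = rmem \<sigma> ''X''" using X1 by (auto simp: frame_def)
        have F2: "Fr \<sigma>2" using 1 F1 unfolding Fr_def by (auto intro: frame_trans)
        have root2: "parent \<sigma>2 j = 0"
          using 1 5 rerooting.new_root[of "parent \<sigma>1" "parent \<sigma>2" "path \<sigma>1" "len \<sigma>1"] by auto
        have inv2: "forest (edges D) (rmem \<sigma>2 ''X'') (parent \<sigma>2)"
          unfolding X2 by (rule forest_inv_reroot[OF inv]) (use 1 par1 in auto)
        show ?case
        proof (rule run_Seq, rule run_walk_com[where v = "n + i" and N = N], goal_cases)
          case (5 \<sigma>3)
          then have par3: "nmem \<sigma>3 ''par'' = nmem \<sigma>2 ''par''" and X3: "rmem \<sigma>3 ''X'' = rmem \<sigma>2 ''X''"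
            by (auto simp: frame_def)
          have F3: "Fr \<sigma>3" using 5 F2 unfolding Fr_def by (auto intro: frame_trans)
          note eqs3 = eqs[OF F3]
          have start: "path \<sigma>3 0 = n + i" and chain: "chain (parent \<sigma>3) (path \<sigma>3) (len \<sigma>3)"
            and root: "parent \<sigma>3 (path \<sigma>3 (len \<sigma>3)) = 0" and bound: "\<forall>t\<le>len \<sigma>3. path \<sigma>3 t < N" "len \<sigma>3 < N"
            using 5 by (auto simp: par3)
          have inv3: "forest (edges D) (rmem \<sigma>3 ''X'') (parent \<sigma>3)" using inv2 by (simp add: X3 par3)
          show ?case
          proof (rule run_Cond_le, goal_cases)
            case 1
            then have last: "path \<sigma>3 (len \<sigma>3) = j" by (simp add: eqs3)
            show ?case
            proof (rule run_Cond_le, goal_cases)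
              case 1
              have "run f cancel_com \<sigma>3 (30 + 14 * len \<sigma>3)
                (\<lambda>\<sigma>'. frame {''path'', ''t'', ''b'', ''par''} {''y'', ''th'', ''X''} \<sigma>3 \<sigma>' \<and>
                   forest (insert (path \<sigma>3 0, path \<sigma>3 (len \<sigma>3)) (edges D)) (rmem \<sigma>' ''X'') (parent \<sigma>'))"
                by (rule run_cancel_com[OF inv3 eqs3(4) chain root])
                  (use 1 bound ij a in \<open>auto simp: start last cf_machine cf_job N_def\<close>)
              then show ?case
              proof (rule run_mono, goal_cases)
                case (1 \<sigma>4)
                then have "Fr \<sigma>4" using F3 unfolding Fr_def by (auto intro: frame_trans)
                then show ?case using 1 a by (intro finish) (auto simp: start last)
              qed (use bound in simp)
            next
              case 2
              \<comment> \<open>Length 0 would identify a machine vertex with a job; length 1 means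
                that the edge already is a pointer.\<close>
              have "len \<sigma>3 \<noteq> 0" using start last ij by (intro notI) simp
              then have "len \<sigma>3 = 1" using 2 by simp
              then have "parent \<sigma>3 (n + i) = Suc j" using chain start last by (simp add: chain_def)
              then have "forest (insert (n + i, j) (edges D)) (rmem \<sigma>3 ''X'') (parent \<sigma>3)"
                by (intro forest_inv_insert inv3) (simp add: adj_def)
              then show ?case using F3 a by (intro run_Skip finish) auto
            qed simp
          next
            case 2
            then have last: "path \<sigma>3 (len \<sigma>3) \<noteq> j" by (auto simp: eqs3)
            have "forest (insert (n + i, j) (edges D)) (rmem \<sigma>3 ''X'') ((parent \<sigma>3)(j := Suc (n + i)))"
              using forest_inv_link[OF inv3 chain root _ last] root2 start a ij
              by (auto simp: par3 cf_machine cf_job N_def)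
            then show ?case
              using F3 a by (intro run_NAssign finish) (auto simp: Fr_def eqs3 fun_upd_def if_distrib[of "\<lambda>h. h 0"] cong: if_cong)
          qed simp
        qed (use ij inputs eqs[OF F2] validity[OF inv2] in \<open>auto simp: N_def\<close>)
      qed
    qed (use ij inputs validity[OF inv] in \<open>auto simp: N_def\<close>)
    then show ?case by (rule run_mono) (simp_all add: N_def)
  next
    case 2
    then have "\<not> 0 < a i j" using ij inputs c by (simp add: cf_machine)
    then show ?case using st by (intro run_Skip) (auto simp: Fr_def forest_state_def edges_insert)
  qed simp
qed

lemma forest_state_setup:
  assumes "setup_inv ({..<m} \<times> {..<n}) \<sigma>"
  shows "forest_state {} \<sigma>"
proof -
  have "setup_frame \<sigma>" using assms by (simp add: setup_inv_def)
  then have "forest_frame \<sigma>" by (rule frame_mono) auto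
  \<comment> \<open>The pointers still have their initial value 0, so every vertex is a
    root.\<close>
  moreover have "nmem \<sigma> ''par'' = (\<lambda>u v. 0)"
    using \<open>setup_frame \<sigma>\<close> by (simp add: frame_def input_state_def)
  moreover have "forest {} x\<^sub>0 (\<lambda>v. 0)"
  proof -
    have "x\<^sub>0 u v = x\<^sub>0 v u" for u v unfolding sol_def by (cases "n \<le> u"; cases "n \<le> v") simp_all
    moreover have "0 \<le> x\<^sub>0 u v" for u v unfolding sol_def using x_nonneg by simp
    ultimately show ?thesis unfolding forest_inv_def acyclic_ptr_def by simp
  qed
  ultimately show ?thesis using assms by (simp add: forest_state_def setup_inv_def edges_def)
qed

lemma run_forest_com:
  assumes "setup_inv ({..<m} \<times> {..<n}) \<sigma>"
  shows "run f forest_com \<sigma> (2 + n * (4 + m * (52 + 23 * (n + m)))) (forest_state ({..<m} \<times> {..<n}))"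
proof -
  let ?J = "\<lambda>j \<sigma>. forest_state ({..<m} \<times> {..<j}) \<sigma> \<and> nmem \<sigma> ''j'' 0 0 = j"
  let ?I = "\<lambda>j i \<sigma>. forest_state ({..<m} \<times> {..<j} \<union> {..<i} \<times> {j}) \<sigma> \<and>
    nmem \<sigma> ''j'' 0 0 = j \<and> nmem \<sigma> ''i'' 0 0 = i"
  have upd: "forest_state D (\<sigma>\<lparr>nmem := upd2 (nmem \<sigma>) v k l w\<rparr>) \<longleftrightarrow> forest_state D \<sigma>"
    if "v \<in> {''i'', ''j''}" for D \<sigma> v k l w
    using that by (auto simp: forest_state_def)
  have "run f forest_com \<sigma> (2 + n * ((2 + m * ((50 + 23 * (n + m)) + 2)) + 2)) (?J n)"
    unfolding forest_com_def
  proof (rule run_For[where J = ?J], goal_cases)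
    case 1
    show ?case using forest_state_setup[OF assms] by (simp add: upd)
  next
    case (2 k \<sigma>)
    then show ?case using forest_frame_inputs[of \<sigma>] by (simp add: forest_state_def)
  next
    case (3 j \<sigma>)
    have "run f (For ''i'' (NVar ''m'') insert_com) \<sigma> (2 + m * ((50 + 23 * (n + m)) + 2)) (?I j m)"
    proof (rule run_For[where J = "?I j"], goal_cases)
      case 1
      show ?case using 3 by (simp add: upd)
    next
      case (2 k \<sigma>2)
      then show ?case using forest_frame_inputs[of \<sigma>2] by (simp add: forest_state_def)
    next
      case (3 i \<sigma>2)
      have D: "insert (i, j) ({..<m} \<times> {..<j} \<union> {..<i} \<times> {j}) = {..<m} \<times> {..<j} \<union> {..<Suc i} \<times> {j}"
        by auto
      have "run f insert_com \<sigma>2 (50 + 23 * (n + m))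
          (\<lambda>\<sigma>'. frame {''L'', ''path'', ''t'', ''b'', ''par''} {''y'', ''th'', ''X''} \<sigma>2 \<sigma>' \<and>
             forest_state (insert (i, j) ({..<m} \<times> {..<j} \<union> {..<i} \<times> {j})) \<sigma>')"
        using 3 \<open>j < n\<close> by (intro run_insert_com) auto
      then show ?case
        by (rule run_mono) (use 3 D in \<open>auto simp: upd frame_def\<close>)
    qed
    moreover have "{..<m} \<times> {..<j} \<union> {..<m} \<times> {j} = {..<m} \<times> {..<Suc j}" by auto
    ultimately show ?case
      by (elim run_mono) (auto simp: upd)
  qed
  then show ?thesis by (rule run_mono) (auto simp: algebra_simps)
qed

section \<open>What the final forest provides\<close>

definition rounded :: "(nat \<Rightarrow> nat \<Rightarrow> real) \<Rightarrow> (nat \<Rightarrow> nat) \<Rightarrow> bool" where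
  "rounded X par \<longleftrightarrow>
     (\<forall>i<m. \<forall>j<n. 0 \<le> X (n + i) j) \<and>
     (\<forall>j<n. (\<Sum>i<m. X (n + i) j) = 1) \<and>
     (\<forall>i<m. (\<Sum>j<n. a i j * X (n + i) j) \<le> C) \<and>
     (\<forall>i<m. \<forall>j<n. s i j = 0 \<longrightarrow> X (n + i) j = 0) \<and>
     (\<forall>i<m. \<forall>j<n. 0 < X (n + i) j \<longrightarrow> 0 < a i j \<longrightarrow> par (n + i) = Suc j \<or> par j = Suc (n + i))"

text \<open>Rows of jobs have coefficients 1 and equations, so shares still sum to 1; rows of
  machines carry the loads. An edge of speed 0 has coefficient 0 and hence keeps its LP weight,
  which is 0.\<close>

lemma rounded_forest:
  assumes "forest (edges ({..<m} \<times> {..<n})) X par"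
  shows "rounded X par"
proof -
  have jobs: "(\<Sum>u<n+m. cf j u * Y j u) = (\<Sum>i<m. Y j (n + i))" if "j < n" for Y :: "nat \<Rightarrow> nat \<Rightarrow> real" and j
    unfolding sum_lessThan_add using that by (simp add: coef_def)
  have machines: "(\<Sum>u<n+m. cf (n + i) u * Y (n + i) u) = (\<Sum>j<n. a i j * Y (n + i) j)" if "i < m" for Y :: "nat \<Rightarrow> nat \<Rightarrow> real" and i
    unfolding sum_lessThan_add using that by (simp add: coef_def)
  have sym: "X u v = X v u" and nonneg: "0 \<le> X u v"
    and fixed: "\<not> (0 < cf u v \<and> 0 < cf v u) \<Longrightarrow> X u v = x\<^sub>0 u v" for u v
    using assms unfolding forest_inv_def by blast+
  have "(\<Sum>i<m. X (n + i) j) = 1" if "j < n" for j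
  proof -
    have "(\<Sum>i<m. X (n + i) j) = (\<Sum>i<m. X j (n + i))" using sym by simp
    also have "\<dots> = (\<Sum>i<m. x\<^sub>0 j (n + i))"
    proof -
      have "(\<Sum>u<n+m. cf j u * X j u) = (\<Sum>u<n+m. cf j u * x\<^sub>0 j u)"
        using assms that unfolding forest_inv_def by blast
      then show ?thesis unfolding jobs[OF that] .
    qed
    also have "\<dots> = (\<Sum>i<m. x i j)" using that by (simp add: sol_def)
    finally show ?thesis using x_sum that by simp
  qed
  moreover have "(\<Sum>j<n. a i j * X (n + i) j) \<le> C" if "i < m" for i
  proof -
    have "(\<Sum>j<n. a i j * X (n + i) j) \<le> (\<Sum>j<n. a i j * x\<^sub>0 (n + i) j)"
    proof -
      have "n + i < n + m" using that by simp
      then have "(\<Sum>u<n+m. cf (n + i) u * X (n + i) u) \<le> (\<Sum>u<n+m. cf (n + i) u * x\<^sub>0 (n + i) u)"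
        using assms unfolding forest_inv_def by blast
      then show ?thesis unfolding machines[OF that] .
    qed
    also have "\<dots> = (\<Sum>j<n. a i j * x i j)" using that by (simp add: sol_def)
    finally show ?thesis using load that by fastforce
  qed
  moreover have "X (n + i) j = 0" if "i < m" "j < n" "s i j = 0" for i j
    using fixed[of "n + i" j] that cf_machine[of i j] x_eq_0 by (simp add: a_def sol_def)
  moreover have "par (n + i) = Suc j \<or> par j = Suc (n + i)"
    if "i < m" "j < n" "0 < X (n + i) j" "0 < a i j" for i j
  proof -
    have "(n + i, j) \<in> edges ({..<m} \<times> {..<n})" using that by (auto simp: edges_def)
    then show ?thesis using assms that unfolding forest_inv_def adj_def by blast
  qed
  ultimately show ?thesis using nonneg unfolding rounded_def by blast
qed

end


section \<open>Rounding a forest solution\<close>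

context lp_solution
begin

definition theta :: real where "theta = 1 - ln p / p"
text \<open>The time that \<open>ptime_split_le\<close> grants for a total share of
  \<open>1 - theta\<close>; all single-machine jobs start no earlier than this.\<close>

definition base :: real where "base = (p / ln p) powr (1 / p) * C"

lemma ln_reg: "0 < ln p" "ln p < p"
  using reg ln_less_self[of p] by auto

lemma theta_pos: "0 < theta"
  using ln_reg reg by (simp add: theta_def)

lemma base_nonneg: "0 \<le> base"
  using C_pos by (simp add: base_def)

lemma eff_speed_mono: "finite B \<Longrightarrow> A \<subseteq> B \<Longrightarrow> eff_speed I j A \<le> eff_speed I j B"
  unfolding eff_speed_def using reg by (intro powr_mono2 sum_mono2) (auto intro: sum_nonneg)

lemma eff_speed_singleton: "eff_speed I j {i} = real (s i j)"
  using reg by (simp add: eff_speed_def powr_powr)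

text \<open>For \<open>a i j > 0\<close> the product form says that the share is at least
  \<open>theta\<close>; for \<open>a i j = 0\<close> every positive share qualifies. In a rounded
  solution a positive share also guarantees a positive speed.\<close>

definition heavy :: "(nat \<Rightarrow> nat \<Rightarrow> real) \<Rightarrow> nat \<Rightarrow> nat \<Rightarrow> bool" where
  "heavy X i j \<longleftrightarrow> 0 < X (n + i) j \<and> theta * a i j \<le> a i j * X (n + i) j"

lemma rounded_singleton:
  assumes X: "rounded X par" and "i < m" "j < n" "heavy X i j"
  shows "set_ptime I j {i} = ereal (f j (real (s i j)))" "0 \<le> f j (real (s i j))"
    "theta * f j (real (s i j)) \<le> a i j * X (n + i) j"
proof -
  have s: "0 < s i j" using assms by (cases "s i j") (auto simp: rounded_def heavy_def)
  show "set_ptime I j {i} = ereal (f j (real (s i j)))" "0 \<le> f j (real (s i j))"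
    using s \<open>j < n\<close> by (simp_all add: set_ptime_def eff_speed_singleton ptime_eq f_nonneg)
  have "theta * f j (real (s i j)) \<le> theta * a i j"
    using f_le_a[OF \<open>j < n\<close> s] theta_pos by simp
  then show "theta * f j (real (s i j)) \<le> a i j * X (n + i) j"
    using assms by (simp add: heavy_def)
qed

text \<open>Only the pointer edge of \<open>j\<close> itself is lost, and it carries less than \<open>theta\<close>.\<close>

lemma rounded_split:
  assumes X: "rounded X par" and j: "j < n" and light: "\<And>i. i < m \<Longrightarrow> \<not> heavy X i j"
  shows "set_ptime I j {i. i < m \<and> par (n + i) = Suc j} \<le> ereal base"
proof -
  let ?X = "\<lambda>i. X (n + i) j"
  define Z where "Z = {i. i < m \<and> 0 < ?X i}"
  define A where "A = {i \<in> Z. par (n + i) = Suc j}"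
  have Xr: "0 \<le> X (n + i) k" if "i < m" "k < n" for i k using X that unfolding rounded_def by blast
  have fin: "finite Z" "finite A" "finite (Z - A)" by (auto simp: Z_def A_def)
  have sum1: "(\<Sum>i<m. ?X i) = 1" using X j unfolding rounded_def by blast
  have "(\<Sum>i\<in>Z. ?X i) = (\<Sum>i<m. ?X i)"
    using Xr[OF _ j] by (intro sum.mono_neutral_left) (auto simp: Z_def not_less intro: antisym)
  then have sumZ: "(\<Sum>i\<in>Z. ?X i) = 1" using sum1 by simp
  \<comment> \<open>A light job has no weight on edges with coefficient 0, so its whole support lies
    in the forest.\<close>
  have Z: "0 < a i j \<and> ?X i < theta" if "i \<in> Z" for i
  proof -
    have "\<not> theta * a i j \<le> a i j * ?X i" using light[of i] that by (auto simp: heavy_def Z_def)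
    then have "a i j * ?X i < a i j * theta" by (simp add: mult.commute)
    moreover have "0 \<le> a i j" using a_nonneg j by blast
    ultimately show ?thesis by (cases "a i j = 0") (auto simp: mult_less_cancel_left)
  qed
  have lost: "par j = Suc (n + i)" if "i \<in> Z - A" for i
    using that Z[of i] X j unfolding rounded_def by (auto simp: Z_def A_def)
  have "(\<Sum>i\<in>Z - A. ?X i) \<le> theta"
  proof (cases "Z - A = {}")
    case True
    then show ?thesis using theta_pos by (simp only: sum.empty)
  next
    case False
    then obtain i where i: "i \<in> Z - A" by blast
    have "k = i" if "k \<in> Z - A" for k using lost[OF that] lost[OF i] by simp
    then have "Z - A = {i}" using i by blast
    moreover have "?X i < theta" using Z[of i] i by blast
    ultimately show ?thesis by simp
  qed
  moreover have "(\<Sum>i\<in>Z. ?X i) = (\<Sum>i\<in>A. ?X i) + (\<Sum>i\<in>Z - A. ?X i)"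
    using fin by (subst sum.union_disjoint[symmetric]) (auto simp: A_def intro: sum.cong)
  ultimately have mass: "ln p / p \<le> (\<Sum>i\<in>A. ?X i)"
    using sumZ by (simp add: theta_def)
  have A: "0 < s i j \<and> 0 \<le> ?X i \<and> ?X i \<le> 1 \<and> a i j * ?X i \<le> C" if "i \<in> A" for i
  proof -
    have i: "i < m" "0 < ?X i" using that by (auto simp: A_def Z_def)
    have "0 < s i j" using i X j by (cases "s i j") (auto simp: rounded_def)
    moreover have "?X i \<le> (\<Sum>i<m. ?X i)"
      using i Xr j by (intro member_le_sum[where f = ?X]) auto
    moreover have "a i j * ?X i \<le> (\<Sum>j<n. a i j * X (n + i) j)"
      using i j Xr a_nonneg by (intro member_le_sum[where f = "\<lambda>j. a i j * X (n + i) j"]) auto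
    moreover have "(\<Sum>j<n. a i j * X (n + i) j) \<le> C" using X i unfolding rounded_def by blast
    ultimately show ?thesis using i sum1 by auto
  qed
  \<comment> \<open>Machines that point to \<open>j\<close> but carry no share are used as well;
    they only raise the speed.\<close>
  have "set_ptime I j {i. i < m \<and> par (n + i) = Suc j} \<le> ptime I j (eff_speed I j A)"
    unfolding set_ptime_def
  proof (rule ptime_le_mono[OF j])
    show "0 \<le> eff_speed I j A" by (simp add: eff_speed_def)
    show "eff_speed I j A \<le> eff_speed I j {i. i < m \<and> par (n + i) = Suc j}"
      by (rule eff_speed_mono) (auto simp: A_def Z_def)
  qed
  also have "\<dots> \<le> ereal ((1 / (ln p / p)) powr (1 / p) * C)"
    using ln_reg(1) less_imp_le[OF ln_reg(2)] reg by (intro ptime_split_le[OF j fin(2) _ _ mass A]) auto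
  finally show ?thesis by (simp add: base_def)
qed

text \<open>\<open>sg j\<close> is \<open>Suc i\<close> if job \<open>j\<close> is put on the single machine \<open>i\<close>, and \<open>0\<close> if it is split
  among the machines whose pointer is \<open>j\<close>.\<close>

definition chosen :: "(nat \<Rightarrow> nat) \<Rightarrow> nat \<Rightarrow> nat \<Rightarrow> nat \<Rightarrow> bool" where
  "chosen par w j i \<longleftrightarrow> w = Suc i \<or> w = 0 \<and> par (n + i) = Suc j"

definition choice :: "(nat \<Rightarrow> nat \<Rightarrow> real) \<Rightarrow> nat \<Rightarrow> nat \<Rightarrow> bool" where
  "choice X j w \<longleftrightarrow> (if w = 0 then \<forall>i<m. \<not> heavy X i j else w - 1 < m \<and> heavy X (w - 1) j)"

text \<open>\<open>w\<close> is a value of \<open>sg\<close>, thus \<open>Suc i\<close> for machine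
  \<open>i\<close>. The jobs of a machine are queued by increasing number.\<close>

definition work :: "(nat \<Rightarrow> nat) \<Rightarrow> nat \<Rightarrow> nat \<Rightarrow> real" where
  "work sg k w = (\<Sum>j<k. if sg j = w then f j (real (s (w - 1) j)) else 0)"

definition start :: "(nat \<Rightarrow> nat) \<Rightarrow> nat \<Rightarrow> real" where
  "start sg j = (if sg j = 0 then 0 else base + work sg j (sg j))"

lemma schedule_rounded:
  assumes X: "rounded X par" and sg: "\<And>j. j < n \<Longrightarrow> choice X j (sg j)"
    and S: "\<And>j. j < n \<Longrightarrow> S j = {i. i < m \<and> chosen par (sg j) j i}"
    and tau: "\<And>j. j < n \<Longrightarrow> \<tau> j = start sg j"
  shows "feasible_schedule I S \<tau>"
    and "makespan I S \<tau> \<le> ereal ((p / (p - ln p) + (p / ln p) powr (1 / p)) * C)"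
proof -
  have single: "S j = {sg j - 1}" "sg j - 1 < m" "heavy X (sg j - 1) j" if "j < n" "sg j \<noteq> 0" for j
  proof -
    have "(sg j = Suc i) = (i = sg j - 1)" for i using that(2) by linarith
    then have "chosen par (sg j) j i \<longleftrightarrow> i = sg j - 1" for i using that(2) by (simp add: chosen_def)
    moreover show "sg j - 1 < m" "heavy X (sg j - 1) j"
      using sg[OF that(1)] that(2) by (simp_all add: choice_def)
    ultimately show "S j = {sg j - 1}" unfolding S[OF that(1)] by (simp add: set_eq_iff) blast
  qed
  have time: "set_ptime I j (S j) = ereal (f j (real (s (sg j - 1) j)))"
      "0 \<le> f j (real (s (sg j - 1) j))"
      "theta * f j (real (s (sg j - 1) j)) \<le> a (sg j - 1) j * X (n + (sg j - 1)) j"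
    if "j < n" "sg j \<noteq> 0" for j
    using rounded_singleton[OF X single(2)[OF that] that(1) single(3)[OF that]]
    unfolding single(1)[OF that] by this
  have split: "set_ptime I j (S j) \<le> ereal base" "\<tau> j = 0" if "j < n" "sg j = 0" for j
    using rounded_split[OF X that(1)] S[OF that(1)] sg[OF that(1)] tau[OF that(1)] that(2)
    by (auto simp: choice_def chosen_def start_def)
  have work_mono: "work sg k w \<le> work sg l w" if "k \<le> l" "l \<le> n" "w \<noteq> 0" for k l w
    unfolding work_def using that time(2) by (intro sum_mono2) auto
  have work_nonneg: "0 \<le> work sg k w" if "k \<le> n" "w \<noteq> 0" for k w
    using work_mono[of 0 k w] that by (simp add: work_def)
  have \<tau>_single: "\<tau> j = base + work sg j (sg j)" if "j < n" "sg j \<noteq> 0" for j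
    using tau that by (simp add: start_def)
  have finish: "ereal (\<tau> j) + set_ptime I j (S j) = ereal (base + work sg (Suc j) (sg j))"
    if "j < n" "sg j \<noteq> 0" for j
    using \<tau>_single[OF that] time(1)[OF that] by (simp add: work_def)
  have \<tau>_nonneg: "0 \<le> \<tau> j" if "j < n" for j
    using split(2) \<tau>_single work_nonneg base_nonneg that by (cases "sg j = 0") auto
  have before: "ereal (\<tau> j) + set_ptime I j (S j) \<le> ereal (\<tau> k)"
    if "j < n" "k < n" "sg j = 0" "sg k \<noteq> 0" for j k
  proof -
    have "ereal (\<tau> j) + set_ptime I j (S j) \<le> ereal base"
      using split[of j] that by simp
    also have "\<dots> \<le> ereal (\<tau> k)" using \<tau>_single[of k] work_nonneg[of k "sg k"] that by simp
    finally show ?thesis .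
  qed
  have sequential: "ereal (\<tau> j) + set_ptime I j (S j) \<le> ereal (\<tau> k)"
    if "j < k" "k < n" "sg j = sg k" "sg k \<noteq> 0" for j k
    using finish[of j] \<tau>_single[of k] work_mono[of "Suc j" k "sg k"] that by simp
  show "feasible_schedule I S \<tau>"
    unfolding feasible_schedule_def
  proof (intro conjI ballI impI)
    fix j assume "j \<in> jobs I"
    then show "S j \<subseteq> machines I" "0 \<le> \<tau> j" using S \<tau>_nonneg by (auto simp: jobs_def machines_def)
  next
    fix j k assume jk: "j \<in> jobs I" "k \<in> jobs I" "j \<noteq> k \<and> S j \<inter> S k \<noteq> {}"
    then have lt: "j < n" "k < n" by (auto simp: jobs_def)
    from jk obtain i where i: "chosen par (sg j) j i" "chosen par (sg k) k i" "j \<noteq> k"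
      using S lt by auto
    \<comment> \<open>Two split jobs cannot share a machine, since its pointer has a single value;
      two single-machine jobs on the same machine have equal \<open>sg\<close>.\<close>
    consider "sg j = 0" "sg k \<noteq> 0" | "sg j \<noteq> 0" "sg k = 0" | "sg j \<noteq> 0" "sg j = sg k"
      using i by (auto simp: chosen_def)
    then show "ereal (\<tau> j) + set_ptime I j (S j) \<le> ereal (\<tau> k) \<or>
        ereal (\<tau> k) + set_ptime I k (S k) \<le> ereal (\<tau> j)"
    proof cases
      case 3
      then show ?thesis using sequential[of j k] sequential[of k j] lt i(3) by (cases "j < k") auto
    qed (use before lt in auto)
  qed
  \<comment> \<open>Every job on the machine is charged to its own term of the load, at a loss of
    \<open>1 / theta\<close>.\<close>
  have total: "work sg n w \<le> C / theta" if w: "w \<noteq> 0" "w - 1 < m" for w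
  proof -
    have "theta * work sg n w = (\<Sum>j<n. if sg j = w then theta * f j (real (s (w - 1) j)) else 0)"
      unfolding work_def sum_distrib_left by (rule sum.cong) auto
    also have "\<dots> \<le> (\<Sum>j<n. a (w - 1) j * X (n + (w - 1)) j)"
    proof (rule sum_mono)
      fix j assume "j \<in> {..<n}"
      then have j: "j < n" by simp
      have "0 \<le> a (w - 1) j * X (n + (w - 1)) j" using a_nonneg[OF j] X w j by (auto simp: rounded_def)
      then show "(if sg j = w then theta * f j (real (s (w - 1) j)) else 0) \<le> a (w - 1) j * X (n + (w - 1)) j"
        using time(3)[OF j] w by auto
    qed
    also have "\<dots> \<le> C" using X w unfolding rounded_def by blast
    finally show ?thesis using theta_pos by (simp add: pos_le_divide_eq mult.commute)
  qed
  have bound: "(p / (p - ln p) + (p / ln p) powr (1 / p)) * C = base + C / theta"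
    using ln_reg reg by (simp add: base_def theta_def field_simps)
  have "ereal (\<tau> j) + set_ptime I j (S j) \<le> ereal (base + C / theta)" if j: "j < n" for j
  proof (cases "sg j = 0")
    case True
    then have "ereal (\<tau> j) + set_ptime I j (S j) \<le> ereal base" using split[OF j] by simp
    also have "\<dots> \<le> ereal (base + C / theta)" using theta_pos C_pos by simp
    finally show ?thesis .
  next
    case False
    then show ?thesis
      using finish[OF j False] work_mono[of "Suc j" n "sg j"] total[of "sg j"] single[OF j False] j by simp
  qed
  then show "makespan I S \<tau> \<le> ereal ((p / (p - ln p) + (p / ln p) powr (1 / p)) * C)"
    unfolding makespan_def bound using base_nonneg theta_pos C_pos by (auto simp: jobs_def)
qed

end


section \<open>The scheduling program\<close>

text \<open>A later heavy machine overwrites an earlier one; any of them will do.\<close>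

definition choose_com :: com where
  "choose_com =
   For ''i'' (NVar ''m'')
     (Cond (BAnd (RLess (ROf (NConst 0)) (RCell ''X'' machine_vertex (NVar ''j'')))
             (BNot (RLess (RMul (RCell ''c'' machine_vertex (NVar ''j'')) (RCell ''X'' machine_vertex (NVar ''j'')))
                      (RMul (RVar ''theta'') (RCell ''c'' machine_vertex (NVar ''j''))))))
        (NArr ''single'' (NVar ''j'') (succ (NVar ''i'')))
        Skip)"

abbreviation chosen_machine :: nexp where "chosen_machine \<equiv> NSub (NAt ''single'' (NVar ''j'')) (NConst 1)"

definition single_com :: com where
  "single_com =
   Seq (NAssign ''S'' chosen_machine (NVar ''j'') (NConst 1))
  (Seq (RArr ''tau'' (NVar ''j'') (RAdd (RVar ''base'') (RAt ''load'' chosen_machine)))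
       (RArr ''load'' chosen_machine (RAdd (RAt ''load'' chosen_machine)
          (ROracle (NVar ''j'') (ROf (NCell ''s'' chosen_machine (NVar ''j'')))))))"

definition split_com :: com where
  "split_com =
   For ''i'' (NVar ''m'')
     (Cond (BAnd (BNot (NLess (NAt ''par'' machine_vertex) (succ (NVar ''j''))))
                 (BNot (NLess (succ (NVar ''j'')) (NAt ''par'' machine_vertex))))
        (NAssign ''S'' (NVar ''i'') (NVar ''j'') (NConst 1))
        Skip)"

definition schedule_com :: com where
  "schedule_com =
   Seq (RSet ''theta'' (RSub (ROf (NConst 1)) (RDiv (RLn (RVar ''p'')) (RVar ''p''))))
  (Seq (RSet ''base'' (RMul (RExp (RMul (RDiv (ROf (NConst 1)) (RVar ''p''))
                               (RLn (RDiv (RVar ''p'') (RLn (RVar ''p'')))))) (RVar ''C'')))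
       (For ''j'' (NVar ''n'')
         (Seq choose_com (Cond (NLess (NConst 0) (NAt ''single'' (NVar ''j''))) single_com split_com))))"

context lp_solution
begin

abbreviation "single \<sigma> \<equiv> (\<lambda>j. nmem \<sigma> ''single'' j 0)"

text \<open>Jobs from \<open>k\<close> on still have \<open>single\<close> equal to 0, which
  \<open>choose_com\<close> presupposes. The array \<open>load\<close> does not include
  \<open>base\<close>.\<close>

definition schedule_state :: "(nat \<Rightarrow> nat \<Rightarrow> real) \<Rightarrow> (nat \<Rightarrow> nat) \<Rightarrow> nat \<Rightarrow> state \<Rightarrow> bool" where
  "schedule_state X par k \<sigma> \<longleftrightarrow>
     (\<forall>j. if j < k then choice X j (single \<sigma> j) else single \<sigma> j = 0) \<and>
     (\<forall>i<m. \<forall>j. nmem \<sigma> ''S'' i j \<noteq> 0 \<longleftrightarrow> j < k \<and> chosen par (single \<sigma> j) j i) \<and>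
     (\<forall>j. rmem \<sigma> ''tau'' j 0 = (if j < k then start (single \<sigma>) j else 0)) \<and>
     (\<forall>i. rmem \<sigma> ''load'' i 0 = work (single \<sigma>) k (Suc i))"

definition schedule_env :: "(nat \<Rightarrow> nat \<Rightarrow> real) \<Rightarrow> (nat \<Rightarrow> nat) \<Rightarrow> state \<Rightarrow> bool" where
  "schedule_env X par \<sigma> \<longleftrightarrow> nmem \<sigma> ''n'' 0 0 = n \<and> nmem \<sigma> ''m'' 0 0 = m \<and>
     (\<forall>i<m. \<forall>j<n. nmem \<sigma> ''s'' i j = s i j) \<and> rmem \<sigma> ''c'' = cf \<and> rmem \<sigma> ''X'' = X \<and> parent \<sigma> = par \<and>
     rmem \<sigma> ''theta'' 0 0 = theta \<and> rmem \<sigma> ''base'' 0 0 = base"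

lemma schedule_env_frame:
  assumes "schedule_env X par \<sigma>" "frame {''i'', ''j'', ''single'', ''S''} {''tau'', ''load''} \<sigma> \<sigma>'"
  shows "schedule_env X par \<sigma>'"
proof -
  have "nmem \<sigma>' ''n'' = nmem \<sigma> ''n''" "nmem \<sigma>' ''m'' = nmem \<sigma> ''m''"
    "nmem \<sigma>' ''s'' = nmem \<sigma> ''s''" "nmem \<sigma>' ''par'' = nmem \<sigma> ''par''"
    "rmem \<sigma>' ''c'' = rmem \<sigma> ''c''" "rmem \<sigma>' ''X'' = rmem \<sigma> ''X''"
    "rmem \<sigma>' ''theta'' = rmem \<sigma> ''theta''" "rmem \<sigma>' ''base'' = rmem \<sigma> ''base''"
    using assms(2) by (simp_all add: frame_def)
  then show ?thesis using assms(1) by (simp only: schedule_env_def) blast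
qed

lemma run_choose_com:
  assumes env: "schedule_env X par \<sigma>" and j: "nmem \<sigma> ''j'' 0 0 = j" "j < n" "single \<sigma> j = 0"
  shows "run f choose_com \<sigma> (2 + 4 * m)
    (\<lambda>\<sigma>'. frame {''i'', ''single''} {} \<sigma> \<sigma>' \<and> choice X j (single \<sigma>' j) \<and> (\<forall>k. k \<noteq> j \<longrightarrow> single \<sigma>' k = single \<sigma> k))"
proof -
  let ?J = "\<lambda>i \<sigma>'. frame {''i'', ''single''} {} \<sigma> \<sigma>' \<and> nmem \<sigma>' ''i'' 0 0 = i \<and>
    (if single \<sigma>' j = 0 then \<forall>i'<i. \<not> heavy X i' j else single \<sigma>' j - 1 < m \<and> heavy X (single \<sigma>' j - 1) j) \<and>
    (\<forall>k. k \<noteq> j \<longrightarrow> single \<sigma>' k = single \<sigma> k)"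
  have env': "schedule_env X par \<sigma>'" if "frame {''i'', ''single''} {} \<sigma> \<sigma>'" for \<sigma>'
    by (rule schedule_env_frame[OF env]) (rule frame_mono[OF that]; simp)
  show ?thesis
    unfolding choose_com_def
  proof (rule run_mono, rule run_For[where J = ?J and K = m and B = 2], goal_cases)
    case 1
    show ?case using j by simp
  next
    case (2 i \<sigma>')
    then show ?case using env'[of \<sigma>'] by (simp add: schedule_env_def)
  next
    case (3 i \<sigma>')
    then have env3: "schedule_env X par \<sigma>'" and j3: "nmem \<sigma>' ''j'' 0 0 = j"
      using env' j by (auto simp: frame_def)
    have test: "bval f \<sigma>' (BAnd (RLess (ROf (NConst 0)) (RCell ''X'' machine_vertex (NVar ''j'')))
             (BNot (RLess (RMul (RCell ''c'' machine_vertex (NVar ''j'')) (RCell ''X'' machine_vertex (NVar ''j'')))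
                      (RMul (RVar ''theta'') (RCell ''c'' machine_vertex (NVar ''j'')))))) \<longleftrightarrow> heavy X i j"
      using env3 3 j3 j(2) by (simp add: schedule_env_def heavy_def cf_machine not_less)
    show ?case
    proof (rule run_Cond_le, unfold test, goal_cases)
      case 1
      then show ?case using 3 j3 by (intro run_NAssign) auto
    next
      case 2
      then show ?case using 3 by (intro run_Skip) (auto simp: less_Suc_eq)
    qed simp
  next
    case (4 \<sigma>')
    then show ?case by (auto simp: choice_def)
  qed simp
qed

lemma run_split_com:
  assumes env: "schedule_env X par \<sigma>" and j: "nmem \<sigma> ''j'' 0 0 = j" "j < n"
  shows "run f split_com \<sigma> (2 + 4 * m)
    (\<lambda>\<sigma>'. frame {''i'', ''S''} {} \<sigma> \<sigma>' \<and>
       (\<forall>i k. nmem \<sigma>' ''S'' i k = (if i < m \<and> k = j \<and> par (n + i) = Suc j then 1 else nmem \<sigma> ''S'' i k)))"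
proof -
  let ?J = "\<lambda>l \<sigma>'. frame {''i'', ''S''} {} \<sigma> \<sigma>' \<and> nmem \<sigma>' ''i'' 0 0 = l \<and>
    (\<forall>i k. nmem \<sigma>' ''S'' i k = (if i < l \<and> k = j \<and> par (n + i) = Suc j then 1 else nmem \<sigma> ''S'' i k))"
  have env': "schedule_env X par \<sigma>'" if "frame {''i'', ''S''} {} \<sigma> \<sigma>'" for \<sigma>'
    by (rule schedule_env_frame[OF env]) (rule frame_mono[OF that]; simp)
  show ?thesis
    unfolding split_com_def
  proof (rule run_mono, rule run_For[where J = ?J and K = m and B = 2], goal_cases)
    case 1
    show ?case by simp
  next
    case (2 i \<sigma>')
    then show ?case using env'[of \<sigma>'] by (simp add: schedule_env_def)
  next
    case (3 i \<sigma>')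
    then have env3: "schedule_env X par \<sigma>'" and j3: "nmem \<sigma>' ''j'' 0 0 = j"
      using env' j by (auto simp: frame_def)
    have test: "bval f \<sigma>' (BAnd (BNot (NLess (NAt ''par'' machine_vertex) (succ (NVar ''j''))))
                 (BNot (NLess (succ (NVar ''j'')) (NAt ''par'' machine_vertex)))) \<longleftrightarrow> par (n + i) = Suc j"
      using env3 3 j3 by (auto simp: schedule_env_def)
    show ?case
    proof (rule run_Cond_le, unfold test, goal_cases)
      case 1
      then show ?case using 3 j3 by (intro run_NAssign) auto
    next
      case 2
      then show ?case using 3 by (intro run_Skip) (auto simp: less_Suc_eq)
    qed simp
  next
    case (4 \<sigma>')
    then show ?case by simp
  qed simp
qed

lemma work_cong: "(\<And>j. j < k \<Longrightarrow> sg j = sg' j) \<Longrightarrow> work sg k w = work sg' k w"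
  unfolding work_def by (rule sum.cong) auto

lemma run_schedule_step:
  assumes env: "schedule_env X par \<sigma>" and st: "schedule_state X par j \<sigma>"
    and j: "nmem \<sigma> ''j'' 0 0 = j" "j < n"
  shows "run f (Seq choose_com (Cond (NLess (NConst 0) (NAt ''single'' (NVar ''j''))) single_com split_com)) \<sigma>
     (8 + 8 * m) (\<lambda>\<sigma>'. frame {''i'', ''single'', ''S''} {''tau'', ''load''} \<sigma> \<sigma>' \<and> schedule_state X par (Suc j) \<sigma>')"
proof (rule run_Seq_le[where M = "2 + 4 * m" and N = "6 + 4 * m"], rule run_choose_com[OF env j], goal_cases)
  case 1
  show ?case using st by (simp add: schedule_state_def)
next
  case (2 \<sigma>1)
  define sg where "sg = single \<sigma>1"
  have S1: "nmem \<sigma>1 ''S'' = nmem \<sigma> ''S''" and r1: "rmem \<sigma>1 = rmem \<sigma>" and j1: "nmem \<sigma>1 ''j'' 0 0 = j"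
    using 2 j by (auto simp: frame_def)
  have sg: "choice X j (sg j)" "\<And>k. k \<noteq> j \<Longrightarrow> sg k = single \<sigma> k" using 2 by (auto simp: sg_def)
  have F1: "frame {''i'', ''single'', ''S''} {''tau'', ''load''} \<sigma> \<sigma>1"
    using 2 by (blast intro: frame_mono)
  have env1: "schedule_env X par \<sigma>1"
    by (rule schedule_env_frame[OF env]) (rule frame_mono[OF F1]; simp)
  have choice: "if k < Suc j then choice X k (sg k) else sg k = 0" for k
    using st sg by (cases "k = j") (auto simp: schedule_state_def less_Suc_eq)
  have S: "nmem \<sigma> ''S'' i k \<noteq> 0 \<longleftrightarrow> k < j \<and> chosen par (sg k) k i" if "i < m" for i k
    using st sg(2)[of k] that by (auto simp: schedule_state_def)
  have work: "work (single \<sigma>) k w = work sg k w" if "k \<le> j" for k w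
    using sg(2) that by (intro work_cong) auto
  have tau: "rmem \<sigma> ''tau'' k 0 = (if k < j then start sg k else 0)" for k
    using st sg(2)[of k] work[of k] by (auto simp: schedule_state_def start_def)
  have load: "rmem \<sigma> ''load'' i 0 = work sg j (Suc i)" for i
    using st work by (auto simp: schedule_state_def)
  show ?case
  proof (rule run_Cond_le, goal_cases)
    case 1
    then obtain i where i: "sg j = Suc i" using j1 by (cases "sg j") (auto simp: sg_def)
    then have "i < m" using sg(1) by (simp add: choice_def)
    let ?\<sigma> = "\<sigma>1\<lparr>nmem := upd2 (nmem \<sigma>1) ''S'' i j 1,
      rmem := upd2 (upd2 (rmem \<sigma>1) ''tau'' j 0 (base + rmem \<sigma>1 ''load'' i 0)) ''load'' i 0
        (rmem \<sigma>1 ''load'' i 0 + f j (real (s i j)))\<rparr>"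
    have single': "single ?\<sigma> k = sg k" for k by (simp add: sg_def)
    have "schedule_state X par (Suc j) ?\<sigma>"
      unfolding schedule_state_def single'
    proof (intro conjI allI impI)
      show "if k < Suc j then choice X k (sg k) else sg k = 0" for k by (rule choice)
      show "(nmem ?\<sigma> ''S'' i' k \<noteq> 0) = (k < Suc j \<and> chosen par (sg k) k i')" if "i' < m" for i' k
        using S[OF that, of k] i by (auto simp: S1 chosen_def less_Suc_eq)
      show "rmem ?\<sigma> ''tau'' k 0 = (if k < Suc j then start sg k else 0)" for k
        using tau[of k] load[of i] i by (auto simp: r1 start_def less_Suc_eq)
      show "rmem ?\<sigma> ''load'' i' 0 = work sg (Suc j) (Suc i')" for i'
        using load[of i'] i by (auto simp: r1 work_def)
    qed
    then show ?case
      unfolding single_com_def using F1 env1 j1 j(2) i \<open>i < m\<close>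
      by (intro run_Seq_NAssign_le run_Seq_RAssign_le run_RAssign) (auto simp flip: sg_def simp: schedule_env_def fun_cong[OF sg_def, symmetric])
  next
    case 2
    then have j0: "sg j = 0" using j1 by (simp add: sg_def)
    show ?case
    proof (rule run_mono, rule run_split_com[OF env1 j1 j(2)], goal_cases)
      case (1 \<sigma>2)
      then have single2: "single \<sigma>2 k = sg k" and r2: "rmem \<sigma>2 = rmem \<sigma>" for k using r1 by (auto simp: frame_def sg_def)
      have S2: "nmem \<sigma>2 ''S'' i k = (if i < m \<and> k = j \<and> par (n + i) = Suc j then 1 else nmem \<sigma> ''S'' i k)" for i k
        using 1 by (simp add: S1)
      have "schedule_state X par (Suc j) \<sigma>2"
        unfolding schedule_state_def single2
      proof (intro conjI allI impI)
        show "if k < Suc j then choice X k (sg k) else sg k = 0" for k by (rule choice)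
        show "(nmem \<sigma>2 ''S'' i' k \<noteq> 0) = (k < Suc j \<and> chosen par (sg k) k i')" if "i' < m" for i' k
          using S[OF that, of k] j0 that by (auto simp: S2 chosen_def less_Suc_eq)
        show "rmem \<sigma>2 ''tau'' k 0 = (if k < Suc j then start sg k else 0)" for k
          using tau[of k] j0 by (auto simp: r2 start_def less_Suc_eq)
        show "rmem \<sigma>2 ''load'' i' 0 = work sg (Suc j) (Suc i')" for i'
          using load[of i'] j0 by (auto simp: r2 work_def)
      qed
      moreover have "frame {''i'', ''single'', ''S''} {''tau'', ''load''} \<sigma> \<sigma>2"
        using F1 conjunct1[OF 1] by (rule frame_trans) auto
      ultimately show ?case by blast
    qed simp
  qed simp
qed simp

lemma run_schedule_com:
  assumes "forest_state ({..<m} \<times> {..<n}) \<sigma>"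
  shows "run f schedule_com \<sigma> (4 + n * (10 + 8 * m))
    (\<lambda>\<sigma>'. feasible_schedule I (output_set I \<sigma>') (output_start \<sigma>') \<and>
       makespan I (output_set I \<sigma>') (output_start \<sigma>') \<le> ereal ((p / (p - ln p) + (p / ln p) powr (1 / p)) * C))"
proof -
  define X par where "X = rmem \<sigma> ''X''" and "par = parent \<sigma>"
  have F0: "forest_frame \<sigma>" and c: "rmem \<sigma> ''c'' = cf" and X: "rounded X par"
    using assms rounded_forest by (auto simp: forest_state_def X_def par_def)
  note inputs = forest_frame_inputs[OF F0]
  let ?\<sigma> = "\<sigma>\<lparr>rmem := upd2 (upd2 (rmem \<sigma>) ''theta'' 0 0 theta) ''base'' 0 0 base\<rparr>"
  have "exp (ln (p / ln p) / p) * C = base"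
    using reg ln_reg by (simp add: base_def powr_def)
  note vals = this inputs
  have env: "schedule_env X par ?\<sigma>"
    using inputs c by (simp add: schedule_env_def X_def par_def)
  \<comment> \<open>Nothing has written \<open>single\<close>, \<open>S\<close>, \<open>tau\<close>
    or \<open>load\<close> so far, so they still hold 0.\<close>
  have st: "schedule_state X par 0 ?\<sigma>"
    using F0 by (simp add: schedule_state_def frame_def input_state_def work_def)
  let ?J = "\<lambda>j \<sigma>'. schedule_env X par \<sigma>' \<and> schedule_state X par j \<sigma>' \<and> nmem \<sigma>' ''j'' 0 0 = j"
  define \<sigma>1 where "\<sigma>1 = ?\<sigma>"
  have upd: "schedule_env X par (\<sigma>\<lparr>nmem := upd2 (nmem \<sigma>) ''j'' k l w\<rparr>) \<longleftrightarrow> schedule_env X par \<sigma>"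
    "schedule_state X par i (\<sigma>\<lparr>nmem := upd2 (nmem \<sigma>) ''j'' k l w\<rparr>) \<longleftrightarrow> schedule_state X par i \<sigma>" for \<sigma> k l w i
    by (simp_all add: schedule_env_def schedule_state_def)
  have "run f (For ''j'' (NVar ''n'')
         (Seq choose_com (Cond (NLess (NConst 0) (NAt ''single'' (NVar ''j''))) single_com split_com))) \<sigma>1
      (2 + n * ((8 + 8 * m) + 2)) (?J n)"
  proof (rule run_For[where J = ?J], goal_cases)
    case 1
    show ?case using env st by (simp add: upd flip: \<sigma>1_def)
  next
    case (2 k \<sigma>')
    then show ?case by (simp add: schedule_env_def)
  next
    case (3 j \<sigma>')
    have "run f (Seq choose_com (Cond (NLess (NConst 0) (NAt ''single'' (NVar ''j''))) single_com split_com)) \<sigma>'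
       (8 + 8 * m) (\<lambda>\<sigma>''. frame {''i'', ''single'', ''S''} {''tau'', ''load''} \<sigma>' \<sigma>'' \<and> schedule_state X par (Suc j) \<sigma>'')"
      using 3 by (intro run_schedule_step) auto
    then show ?case
    proof (rule run_mono, goal_cases)
      case (1 \<sigma>'')
      have env': "schedule_env X par \<sigma>''"
        by (rule schedule_env_frame[of _ _ \<sigma>']) (use 3 1 in \<open>auto intro: frame_mono\<close>)
      moreover have "nmem \<sigma>'' ''j'' 0 0 = j" using 1 3 by (simp add: frame_def)
      ultimately show ?case using 1 by (simp add: upd)
    qed simp
  qed
  then have "run f (For ''j'' (NVar ''n'')
         (Seq choose_com (Cond (NLess (NConst 0) (NAt ''single'' (NVar ''j''))) single_com split_com))) \<sigma>1
      (2 + n * (10 + 8 * m))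
      (\<lambda>\<sigma>'. feasible_schedule I (output_set I \<sigma>') (output_start \<sigma>') \<and>
       makespan I (output_set I \<sigma>') (output_start \<sigma>') \<le> ereal ((p / (p - ln p) + (p / ln p) powr (1 / p)) * C))"
  proof (rule run_mono, goal_cases)
    case (1 \<sigma>')
    then have st': "schedule_state X par n \<sigma>'" by blast
    have 1: "choice X j (single \<sigma>' j)" if "j < n" for j
      using st' that unfolding schedule_state_def by metis
    have 2: "output_set I \<sigma>' j = {i. i < m \<and> chosen par (single \<sigma>' j) j i}" if "j < n" for j
      using st' that by (auto simp: output_set_def schedule_state_def machines_def)
    have 3: "output_start \<sigma>' j = start (single \<sigma>') j" if "j < n" for j
      using st' that by (simp add: output_start_def schedule_state_def)
    show ?case using schedule_rounded[OF X 1 2 3] by blast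
  qed (simp add: algebra_simps)
  then show ?thesis
    unfolding schedule_com_def
    by (intro run_Seq_RAssign_le) (simp_all add: vals theta_def[symmetric] \<sigma>1_def)
qed

end

definition rounding_com :: com where
  "rounding_com = Seq setup_com (Seq forest_com schedule_com)"

text \<open>The coefficients result from replacing \<open>n\<close> and \<open>m\<close> by the
  input size in the three step counts and collecting powers; the cubic term stems from
  \<open>n * m\<close> insertions of cost linear in \<open>n + m\<close>.\<close>

lemma (in lp_solution) run_rounding_com:
  "run f rounding_com \<sigma>\<^sub>0 (poly [:8, 38, 82, 46:] (input_size I))
    (\<lambda>\<sigma>'. feasible_schedule I (output_set I \<sigma>') (output_start \<sigma>') \<and>
       makespan I (output_set I \<sigma>') (output_start \<sigma>') \<le> ereal ((p / (p - ln p) + (p / ln p) powr (1 / p)) * C))"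
proof -
  define z where "z = input_size I"
  have nm: "n \<le> z" "m \<le> z" "n + m \<le> z + z" by (simp_all add: z_def input_size_def)
  have 1: "n * (24 + 12 * z + 10 * m) \<le> z * (24 + 12 * z + 10 * z)"
    using nm by (intro mult_le_mono add_le_mono) auto
  have 2: "n * (4 + m * (52 + 23 * (n + m))) \<le> z * (4 + z * (52 + 23 * (z + z)))"
    using nm by (intro mult_le_mono add_le_mono) auto
  have 3: "n * (10 + 8 * m) \<le> z * (10 + 8 * z)"
    using nm by (intro mult_le_mono add_le_mono) auto
  have "(2 + z * (24 + 12 * z + 10 * z)) + ((2 + z * (4 + z * (52 + 23 * (z + z)))) + (4 + z * (10 + 8 * z)))
      = poly [:8, 38, 82, 46:] z"
    by (simp add: algebra_simps)
  then have "(2 + n * (24 + 12 * z + 10 * m)) + ((2 + n * (4 + m * (52 + 23 * (n + m)))) + (4 + n * (10 + 8 * m)))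
      \<le> poly [:8, 38, 82, 46:] z"
    using 1 2 3 by linarith
  then show ?thesis
    unfolding rounding_com_def z_def
    by (intro run_Seq_le[OF run_setup_com run_Seq[OF run_forest_com run_schedule_com]])
qed

theorem theorem4p3:
  shows "\<exists>(prog :: com) (T :: nat poly).
    \<forall>(I :: malleable_instance) (C :: real) (x :: nat \<Rightarrow> nat \<Rightarrow> real).
      valid_instance I \<and> regularizer I \<ge> 2 \<and> C > 0 \<and> gamma_exists I C \<and> lp_feasible I C x \<longrightarrow>
      (\<exists>t \<sigma>.
         exec (ptime_oracle I) prog (input_state I C x) t \<sigma> \<and>
         t \<le> poly T (input_size I) \<and>
         feasible_schedule I (output_set I \<sigma>) (output_start \<sigma>) \<and>
         makespan I (output_set I \<sigma>) (output_start \<sigma>)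
           \<le> ereal ((regularizer I / (regularizer I - ln (regularizer I))
                      + (regularizer I / ln (regularizer I)) powr (1 / regularizer I)) * C))"
proof (intro exI[of _ rounding_com] exI[of _ "[:8, 38, 82, 46:]"] allI impI)
  fix I C x
  assume "valid_instance I \<and> 2 \<le> regularizer I \<and> 0 < C \<and> gamma_exists I C \<and> lp_feasible I C x"
  then interpret lp_solution I C x by unfold_locales auto
  show "\<exists>t \<sigma>. exec (ptime_oracle I) rounding_com (input_state I C x) t \<sigma> \<and>
         t \<le> poly [:8, 38, 82, 46:] (input_size I) \<and>
         feasible_schedule I (output_set I \<sigma>) (output_start \<sigma>) \<and>
         makespan I (output_set I \<sigma>) (output_start \<sigma>)
           \<le> ereal ((regularizer I / (regularizer I - ln (regularizer I))
                      + (regularizer I / ln (regularizer I)) powr (1 / regularizer I)) * C)"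
    using run_rounding_com unfolding run_def .
qed

end
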